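(* Let $1<p,q<\infty$, $\omega\in\mathcal{D}$, $\upsilon$ a positive Borel measure on $\mathbb{D}$, $\varphi,\psi\in S(\mathbb{D})$ and $u_0,u_1\in H(\mathbb{D})$. Then $$\|u_0C_\varphi+u_1D^{(1)}_\psi\|_{A^p_\omega\to L^q_\upsilon}\approx\|u_0C_\varphi\|_{A^p_\omega\to L^q_\upsilon}+\|u_1D^{(1)}_\psi\|_{A^p_\omega\to L^q_\upsilon},$$ with constants independent of $u_0,u_1,\varphi,\psi,\upsilon$ (in particular $u_0C_\varphi+u_1D^{(1)}_\psi:A^p_\omega\to L^q_\upsilon$ is bounded if and only if both $u_0C_\varphi$ and $u_1D^{(1)}_\psi$ are bounded from $A^p_\omega$ to $L^q_\upsilon$).
   Context: $\mathbb{D}$ is the open unit disc, $dA$ the normalized area measure, $H(\mathbb{D})$ the analytic functions on $\mathbb{D}$, $S(\mathbb{D})$ the analytic self-maps of $\mathbb{D}$. For $u\in H(\mathbb{D})$, $\varphi\in S(\mathbb{D})$: $uC_\varphi f=u\,(f\circ\varphi)$ and $uD^{(1)}_\varphi f=u\,(f'\circ\varphi)$. A radial weight is a nonnegative $\omega\in L^1([0,1])$ extended by $\omega(z)=\omega(|z|)$; set $\hat\omega(r)=\int_r^1\omega(t)\,dt$, and assume $\hat\omega(r)>0$ for all $r<1$. $\hat{\mathcal{D}}$ is the class of radial weights with $\hat\omega(r)\le C\hat\omega(\frac{1+r}{2})$ for all $0\le r<1$ and some $C\ge1$; $\mathcal{D}$ is the class of $\omega\in\hat{\mathcal{D}}$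 for which additionally there are $K>1$, $C>1$ with $\hat\omega(r)\ge C\hat\omega(1-\frac{1-r}{K})$ for all $0\le r<1$. $A^p_\omega$ is the space of $f\in H(\mathbb{D})$ with $\|f\|^p_{A^p_\omega}=\int_{\mathbb{D}}|f|^p\omega\,dA<\infty$. $L^q_\upsilon=L^q(\mathbb{D},\upsilon)$. *)

theory Defs
  imports "HOL-Analysis.Analysis"
begin

abbreviation unit_disc :: "complex set" where
  "unit_disc \<equiv> ball 0 1"

definition self_maps :: "(complex \<Rightarrow> complex) set" where
  "self_maps = {\<phi>. \<phi> holomorphic_on unit_disc \<and> \<phi> ` unit_disc \<subseteq> unit_disc}"

definition omega_hat :: "(real \<Rightarrow> real) \<Rightarrow> real \<Rightarrow> real" where
  "omega_hat \<omega> r = (LINT t:{r..1}|lborel. \<omega> t)"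

definition radial_weight :: "(real \<Rightarrow> real) \<Rightarrow> bool" where
  "radial_weight \<omega> \<longleftrightarrow> (\<forall>t\<in>{0..1}. 0 \<le> \<omega> t) \<and> set_integrable lborel {0..1} \<omega>
      \<and> (\<forall>r\<in>{0..<1}. 0 < omega_hat \<omega> r)"

definition weights_Dhat :: "(real \<Rightarrow> real) set" where
  "weights_Dhat = {\<omega>. radial_weight \<omega> \<and>
      (\<exists>C\<ge>1. \<forall>r\<in>{0..<1}. omega_hat \<omega> r \<le> C * omega_hat \<omega> ((1 + r) / 2))}"

definition weights_D :: "(real \<Rightarrow> real) set" where
  "weights_D = {\<omega>. \<omega> \<in> weights_Dhat \<and>
      (\<exists>K>1. \<exists>C>1. \<forall>r\<in>{0..<1}. omega_hat \<omega> r \<ge> C * omega_hat \<omega> (1 - (1 - r) / K))}"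

definition enn_root :: "real \<Rightarrow> ennreal \<Rightarrow> ennreal" where
  "enn_root p x = (if x = \<infinity> then \<infinity> else ennreal (enn2real x powr (1 / p)))"

text \<open>Norm in A^p_\<omega>, w.r.t. normalized area measure dA = dx dy / pi.\<close>
definition Apw_norm :: "real \<Rightarrow> (real \<Rightarrow> real) \<Rightarrow> (complex \<Rightarrow> complex) \<Rightarrow> ennreal" where
  "Apw_norm p \<omega> f = enn_root p
     (\<integral>\<^sup>+ z. indicator unit_disc z * ennreal (norm (f z) powr p * \<omega> (norm z) / pi) \<partial>lborel)"

definition Lq_norm :: "real \<Rightarrow> complex measure \<Rightarrow> (complex \<Rightarrow> complex) \<Rightarrow> ennreal" where
  "Lq_norm q \<upsilon> g = enn_root q (\<integral>\<^sup>+ z. ennreal (norm (g z) powr q) \<partial>\<upsilon>)"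

text \<open>Operator norm A^p_\<omega> \<rightarrow> L^q_\<upsilon> (value \<infinity> iff the operator is unbounded).\<close>
definition op_norm :: "real \<Rightarrow> (real \<Rightarrow> real) \<Rightarrow> real \<Rightarrow> complex measure
     \<Rightarrow> ((complex \<Rightarrow> complex) \<Rightarrow> (complex \<Rightarrow> complex)) \<Rightarrow> ennreal" where
  "op_norm p \<omega> q \<upsilon> T =
     (SUP f \<in> {f. f holomorphic_on unit_disc \<and> Apw_norm p \<omega> f \<le> 1}. Lq_norm q \<upsilon> (T f))"

definition wcomp :: "(complex \<Rightarrow> complex) \<Rightarrow> (complex \<Rightarrow> complex) \<Rightarrow> (complex \<Rightarrow> complex) \<Rightarrow> complex \<Rightarrow> complex" where
  "wcomp u \<phi> f = (\<lambda>z. u z * f (\<phi> z))"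

definition wdiffcomp :: "(complex \<Rightarrow> complex) \<Rightarrow> (complex \<Rightarrow> complex) \<Rightarrow> (complex \<Rightarrow> complex) \<Rightarrow> complex \<Rightarrow> complex" where
  "wdiffcomp u \<psi> f = (\<lambda>z. u z * deriv f (\<psi> z))"

end

theory Submission
  imports Defs "HOL-Complex_Analysis.Complex_Analysis"
begin

text \<open>
  By the triangle inequality it suffices to bound \<open>u0 C\<^sub>\<phi>\<close> by \<open>T = u0 C\<^sub>\<phi> + u1 D\<^sub>\<psi>\<close>. For a point \<open>a\<close> of the
  disc put \<open>k\<^sub>a(z) = (1 - |a|) / (1 - cnj a z)\<close>. At a fixed point, \<open>T\<close> maps the powers of \<open>k\<^sub>a\<close> with
  exponents \<open>m, m + 1, m + 2\<close> to \<open>U x^n + n V y^(n + 1)\<close>, a solution of a linear recurrence with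
  characteristic roots \<open>x\<close> (simple) and \<open>y\<close> (double), and three consecutive terms control \<open>U\<close>
  whenever \<open>|x|\<close> is bounded below, wherever \<open>y\<close> is.

  Let \<open>a\<close> run through the nodes \<open>(1 - B^(-n)) exp(2\<pi>i l / B^n)\<close>, \<open>l < B^n\<close>, and let \<open>w\<^sub>n\<close> be the weight
  \<open>B^(-n) \<omega>hat(1 - B^(-n))\<close>. For \<open>f\<close> in the unit ball, Cauchy's formula on the circles in the annulus
  two levels further out gives \<open>|f|^p w\<^sub>n \<le> C c\<^sub>a^p\<close> near \<open>a\<close>, where the \<open>c\<^sub>a^p\<close> have bounded sum.
  Conversely, every sum of the functions \<open>\<plusminus> c\<^sub>a w\<^sub>n^(-1/p) k\<^sub>a^m\<close> is bounded in the weighted Bergman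
  space; both halves of the condition on \<open>\<omega>\<close> enter here. Averaging \<open>|T(\<dots>)|^q\<close> over all choices of
  signs dominates each single term, hence the integral of \<open>|u0 f(\<phi>)|^q\<close>.
\<close>

text \<open>Testing \<open>T\<close> on a single kernel gives information near one node only,
  whereas \<open>u0 f(\<phi>)\<close> is integrated over points whose images lie near different
  nodes. The test functions therefore superpose all nodes, with coefficients
  \<open>c\<^sub>a\<close> read off from f, and depend neither on the point nor on the operator. The
  signs prevent cancellation between nodes, and the argument is the same for every order of p and q.
  With the two exponents m, m + 1 the determinant of the system for U and V contains the factor (m +
  1) y - m x; if it vanishes, U is not determined. The third exponent removes this degeneracy. The
  least exponent m has to be large: towards the centre the weights \<open>w\<^sub>n\<close> grow, at
  a rate set by the doubling constant, and a high power of the kernel must decay faster. Only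
  finitely many levels are used at a time, so the mean over signs is a finite sum; all constants are
  independent of the number of levels, and monotone convergence finishes.\<close>

section \<open>Elementary inequalities\<close>

text \<open>If \<open>x\<close> and \<open>y\<close> are far apart, applying the second-order difference with double root \<open>y\<close> to the
  three terms isolates \<open>U\<close>; if they are close, the first-order difference with root \<open>x\<close> isolates
  \<open>V y^(m + 1)\<close>, because \<open>(m + 1) y - m x\<close> is then close to \<open>y\<close>.\<close>
lemma separation_of_powers:
  fixes c :: real and m :: nat
  assumes "0 < c"
  shows "\<exists>C>0. \<forall>x y U V :: complex. c \<le> norm x \<longrightarrow> norm x \<le> 1 \<longrightarrow> norm y \<le> 1 \<longrightarrow>
       norm U \<le> C * (\<Sum>k<3. norm (U * x ^ (m + k) + of_nat (m + k) * V * y ^ (m + k + 1)))"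
proof -
  \<comment> \<open>Both \<open>e\<close> and \<open>m * e\<close> are at most \<open>c / 4\<close>:
    in the close case \<open>norm y\<close> is at least \<open>3 * c / 4\<close>, and passing from y
    to (m + 1) y - m x costs at most another \<open>c / 4\<close>.\<close>
  define e where "e = c / (4 * real (m + 1))"
  have e: "0 < e" using assms by (simp add: e_def)
  define C where "C = 2 / (c ^ m * e\<^sup>2) + (1 + 4 * real m / c) / c ^ m"
  show ?thesis
  proof (intro exI[of _ C] conjI allI impI)
    show "0 < C" using assms e by (auto simp: C_def intro!: add_pos_nonneg divide_pos_pos)
    fix x y U V :: complex
    assume x: "c \<le> norm x" "norm x \<le> 1" and y: "norm y \<le> 1"
    define g where "g k = U * x ^ (m + k) + of_nat (m + k) * V * y ^ (m + k + 1)" for k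
    define S where "S = (\<Sum>k<3. norm (g k))"
    have S: "S = norm (g 0) + norm (g 1) + norm (g 2)"
      by (simp add: S_def numeral_3_eq_3 numeral_2_eq_2)
    have S0: "0 \<le> S" by (simp add: S_def sum_nonneg)
    have cm: "0 < c ^ m" using assms by simp
    have xm: "c ^ m \<le> norm x ^ m" using x assms by (intro power_mono) auto
    have "norm U \<le> 2 / (c ^ m * e\<^sup>2) * S \<or> norm U \<le> (1 + 4 * real m / c) / c ^ m * S"
    proof (cases "e \<le> norm (x - y)")
      case True
      have "U * x ^ m * (x - y)\<^sup>2 = g 2 - 2 * y * g 1 + y\<^sup>2 * g 0"
        by (simp add: g_def power2_eq_square algebra_simps power_add)
      then have "norm U * norm x ^ m * norm (x - y) ^ 2 = norm (g 2 - 2 * y * g 1 + y\<^sup>2 * g 0)"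
        by (metis norm_mult norm_power)
      also have "\<dots> \<le> norm (g 2) + norm (2 * y * g 1) + norm (y\<^sup>2 * g 0)"
        by (meson norm_triangle_ineq norm_triangle_ineq4 order_trans add_right_mono)
      also have "\<dots> \<le> norm (g 2) + 2 * norm (g 1) + norm (g 0)"
        using y by (auto simp: norm_mult norm_power intro!: add_mono mult_left_le_one_le power_le_one)
      also have "\<dots> \<le> 2 * S" using S by simp
      finally have "norm U * (norm x ^ m * norm (x - y) ^ 2) \<le> 2 * S" by (simp add: mult.assoc)
      moreover have "norm U * (c ^ m * e\<^sup>2) \<le> norm U * (norm x ^ m * norm (x - y) ^ 2)"
        using xm True e cm by (intro mult_left_mono mult_mono xm power_mono[OF True]) auto
      ultimately have "norm U * (c ^ m * e\<^sup>2) \<le> 2 * S" by linarith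
      then have "norm U \<le> 2 * S / (c ^ m * e\<^sup>2)" using cm e by (subst pos_le_divide_eq) auto
      then show ?thesis by simp
    next
      case False
      have me: "real m * e \<le> c / 4" "e \<le> c / 4" using assms by (auto simp: e_def field_simps)
      have "norm x - norm (x - y) \<le> norm y" by (metis norm_triangle_ineq2 norm_minus_commute diff_le_eq norm_triangle_sub)
      then have ny: "3 * c / 4 \<le> norm y" using x False me by linarith
      have "norm (of_nat m * (y - x)) \<le> real m * e"
        using False by (auto simp: norm_mult norm_minus_commute intro!: mult_left_mono)
      then have "norm y - norm (y + of_nat m * (y - x)) \<le> c / 4"
        using me(1) norm_triangle_ineq4[of "y + of_nat m * (y - x)" "of_nat m * (y - x)"] by simp
      then have yy: "c / 4 \<le> norm (y + of_nat m * (y - x))" using ny assms by linarith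
      have "g 1 - x * g 0 = V * y ^ (m + 1) * (y + of_nat m * (y - x))"
        by (simp add: g_def algebra_simps power_add)
      then have "norm (V * y ^ (m + 1)) * norm (y + of_nat m * (y - x)) = norm (g 1 - x * g 0)"
        by (metis norm_mult)
      also have "\<dots> \<le> norm (g 1) + norm (x * g 0)" by (rule norm_triangle_ineq4)
      also have "\<dots> \<le> norm (g 1) + norm (g 0)" using x by (auto simp: norm_mult intro!: mult_left_le_one_le)
      also have "\<dots> \<le> S" using S by simp
      finally have *: "norm (V * y ^ (m + 1)) * norm (y + of_nat m * (y - x)) \<le> S" .
      have "norm (V * y ^ (m + 1)) * (c / 4) \<le> S"
        using * yy by (meson mult_left_mono norm_ge_zero order_trans)
      then have V: "norm (V * y ^ (m + 1)) \<le> 4 * S / c" using assms by (simp add: field_simps)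
      have "U * x ^ m = g 0 - of_nat m * (V * y ^ (m + 1))" by (simp add: g_def)
      then have "norm (U * x ^ m) \<le> norm (g 0) + norm (of_nat m * (V * y ^ (m + 1)))"
        by (metis norm_triangle_ineq4)
      also have "\<dots> \<le> S + real m * (4 * S / c)"
        using V S unfolding norm_mult[of "of_nat m"] norm_of_nat by (intro add_mono mult_left_mono) auto
      also have "\<dots> = (1 + 4 * real m / c) * S" by (simp add: algebra_simps)
      finally have "norm U * norm x ^ m \<le> (1 + 4 * real m / c) * S" by (simp add: norm_mult norm_power)
      then have "norm U * c ^ m \<le> (1 + 4 * real m / c) * S"
        using xm by (meson mult_left_mono norm_ge_zero order_trans)
      then have "norm U \<le> (1 + 4 * real m / c) * S / c ^ m" using cm by (simp add: pos_le_divide_eq)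
      then show ?thesis by simp
    qed
    moreover have "0 \<le> 2 / (c ^ m * e\<^sup>2) * S" "0 \<le> (1 + 4 * real m / c) / c ^ m * S"
      using assms S0 by auto
    ultimately have "norm U \<le> C * S" unfolding C_def distrib_right by linarith
    then show "norm U \<le> C * (\<Sum>k<3. norm (U * x ^ (m + k) + of_nat (m + k) * V * y ^ (m + k + 1)))"
      by (simp add: S_def g_def)
  qed
qed

text \<open>Jensen's inequality will be applied to sums with vanishing entries, so 0 belongs to the
  domain. If one point is 0, the claim reduces to \<open>s powr p \<le> s\<close> for 0 < s <
  1.\<close>

lemma convex_on_powr_nonneg:
  fixes p :: real
  assumes "1 \<le> p"
  shows "convex_on {0..} (\<lambda>x. x powr p)"
proof (rule convex_onI)
  fix t x y :: real
  assume t: "0 < t" "t < 1" and xy: "x \<in> {0..}" "y \<in> {0..}"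
  have *: "(s * x) powr p \<le> s * x powr p" if "0 < s" "s < 1" "0 \<le> x" for s x :: real
    using that assms powr_mono'[of 1 p s] by (simp add: powr_mult mult_right_mono)
  show "((1 - t) *\<^sub>R x + t *\<^sub>R y) powr p \<le> (1 - t) * x powr p + t * y powr p"
  proof (cases "x = 0 \<or> y = 0")
    case True
    then show ?thesis using *[of t y] *[of "1 - t" x] t xy assms by auto
  next
    case False
    then show ?thesis
      using convex_onD[OF powr_convex[OF assms], of t x y] t xy by simp
  qed
qed simp

text \<open>Jensen's inequality for \<open>x powr p\<close> with the weights \<open>b i\<close>
  divided by their sum. Constant weights give power mean inequalities; kernel-dependent weights will
  control the sum over all nodes.\<close>

lemma weighted_sum_powr_le:
  fixes a b :: "'i \<Rightarrow> real"
  assumes "finite I" "1 \<le> p" "\<And>i. i \<in> I \<Longrightarrow> 0 \<le> a i" "\<And>i. i \<in> I \<Longrightarrow> 0 \<le> b i"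
  shows "(\<Sum>i\<in>I. a i * b i) powr p \<le> (\<Sum>i\<in>I. b i) powr (p - 1) * (\<Sum>i\<in>I. a i powr p * b i)"
proof (cases "(\<Sum>i\<in>I. b i) = 0")
  case True
  then have "\<forall>i\<in>I. b i = 0" using assms by (simp add: sum_nonneg_eq_0_iff)
  then show ?thesis using assms by simp
next
  case False
  define s where "s = (\<Sum>i\<in>I. b i)"
  have s: "0 < s" using False assms by (simp add: s_def sum_nonneg order_less_le)
  have "((\<Sum>i\<in>I. (b i / s) *\<^sub>R a i)) powr p \<le> (\<Sum>i\<in>I. (b i / s) * (a i powr p))"
    using assms s False
    by (intro convex_on_sum[OF _ _ convex_on_powr_nonneg])
       (auto simp: s_def simp flip: sum_divide_distrib)
  moreover have "(\<Sum>i\<in>I. (b i / s) *\<^sub>R a i) = (\<Sum>i\<in>I. a i * b i) / s"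
    by (simp add: sum_divide_distrib mult.commute)
  moreover have "(\<Sum>i\<in>I. (b i / s) * (a i powr p)) = (\<Sum>i\<in>I. a i powr p * b i) / s"
    by (simp add: sum_divide_distrib mult.commute)
  ultimately have "(\<Sum>i\<in>I. a i * b i) powr p / s powr p \<le> (\<Sum>i\<in>I. a i powr p * b i) / s"
    using s assms by (simp add: powr_divide sum_nonneg)
  then have "(\<Sum>i\<in>I. a i * b i) powr p \<le> s powr p * ((\<Sum>i\<in>I. a i powr p * b i) / s)"
    using s by (simp add: divide_le_eq mult.commute)
  also have "\<dots> = s powr (p - 1) * (\<Sum>i\<in>I. a i powr p * b i)"
    using s by (simp add: powr_diff)
  finally show ?thesis by (simp add: s_def)
qed

text \<open>Twice v is the difference of w + v and w - v; convexity of the power does the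
  rest.\<close>

lemma powr_norm_le_add_diff:
  fixes v w :: "'a::real_normed_vector"
  assumes "1 \<le> q"
  shows "2 * norm v powr q \<le> norm (w + v) powr q + norm (w - v) powr q"
proof -
  have "norm (v + v) \<le> norm (w + v) + norm (w - v)"
    using norm_triangle_ineq4[of "w + v" "w - v"] by (simp add: algebra_simps)
  then have "norm v \<le> norm (w + v) * (1/2) + norm (w - v) * (1/2)"
    by (simp flip: scaleR_2)
  then have "norm v powr q \<le> (norm (w + v) * (1/2) + norm (w - v) * (1/2)) powr q"
    using assms by (intro powr_mono2) auto
  also have "\<dots> \<le> norm (w + v) powr q * (1/2) + norm (w - v) powr q * (1/2)"
    using weighted_sum_powr_le[of "{True, False}" q "\<lambda>i. if i then norm (w + v) else norm (w - v)" "\<lambda>i. 1/2"] assms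
    by simp
  finally show ?thesis by simp
qed

text \<open>Pair each S without i with \<open>insert i S\<close>: the two signed sums differ only in
  the sign of \<open>v i\<close>, so the two-term inequality applies with all other terms as w.
  After division by \<open>2 ^ card J\<close> this says that the mean over all signs dominates every
  single term.\<close>

lemma powr_norm_le_sum_signs:
  fixes v :: "'i \<Rightarrow> 'a::real_normed_vector"
  assumes "1 \<le> q" "finite J" "i \<in> J"
  shows "2 ^ card J * norm (v i) powr q
      \<le> (\<Sum>S\<in>Pow J. norm (\<Sum>j\<in>J. if j \<in> S then v j else - v j) powr q)"
proof -
  define J' where "J' = J - {i}"
  have J: "J = insert i J'" "i \<notin> J'" "finite J'" using assms by (auto simp: J'_def)
  define F where "F S = norm (\<Sum>j\<in>J. if j \<in> S then v j else - v j) powr q" for S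
  have "2 * norm (v i) powr q \<le> F (insert i S) + F S" if "S \<in> Pow J'" for S
  proof -
    have "(\<Sum>j\<in>J'. if j \<in> insert i S then v j else - v j) = (\<Sum>j\<in>J'. if j \<in> S then v j else - v j)"
      using J by (intro sum.cong) auto
    then show ?thesis
      using that J powr_norm_le_add_diff[OF assms(1), of "v i" "\<Sum>j\<in>J'. if j \<in> S then v j else - v j"]
      by (auto simp: F_def add.commute)
  qed
  then have "(\<Sum>S\<in>Pow J'. 2 * norm (v i) powr q) \<le> (\<Sum>S\<in>Pow J'. F (insert i S) + F S)"
    by (rule sum_mono)
  also have "\<dots> = (\<Sum>S\<in>Pow J. F S)"
  proof -
    have "inj_on (insert i) (Pow J')" using J(2) by (intro inj_onI) (auto simp: insert_ident)
    moreover have "Pow J' \<inter> insert i ` Pow J' = {}" using J(2) by auto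
    ultimately show ?thesis
      using J unfolding J(1) Pow_insert
      by (subst sum.union_disjoint) (auto simp: sum.reindex sum.distrib add.commute)
  qed
  finally show ?thesis using J by (simp add: F_def card_Pow)
qed

section \<open>Roots of unity, rotations and radial integrals\<close>

lemma sum_roots_unity_orthogonal:
  fixes N j k :: nat
  assumes "j < N" "k < N"
  shows "(\<Sum>l<N. (cis (2 * pi * real k / real N) * cnj (cis (2 * pi * real j / real N))) ^ l)
           = (if j = k then of_nat N else 0)"
proof -
  define e where "e k = cis (2 * pi * real k / real N)" for k
  have N: "N > 0" using assms by simp
  have ee: "e i * cnj (e i) = 1" for i by (simp add: e_def cis_cnj cis_mult)
  have eN: "e i ^ N = 1" for i
    using N cis_multiple_2pi[of "real i"] by (simp add: e_def Complex.DeMoivre)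
  show ?thesis
  proof (cases "j = k")
    case True
    then show ?thesis using ee[of k] by (simp add: e_def)
  next
    case False
    have "inj_on e {..<N}" using Complex.bij_betw_roots_unity[OF N] by (simp add: e_def[abs_def] bij_betw_def)
    then have "e k \<noteq> e j" using False assms by (auto dest: inj_onD)
    moreover have "e k * cnj (e j) = 1 \<Longrightarrow> e k = e j" 
      by (metis ee mult.assoc mult.commute mult.right_neutral)
    ultimately have "e k * cnj (e j) \<noteq> 1" by auto
    moreover have "(e k * cnj (e j)) ^ N = 1"
      using eN by (simp add: power_mult_distrib flip: complex_cnj_power)
    ultimately show ?thesis
      using False geometric_sum[of "e k * cnj (e j)" N] unfolding e_def by simp
  qed
qed

lemma sum_roots_unity_Parseval:
  fixes c :: "nat \<Rightarrow> complex"
  shows "(\<Sum>l<N. (norm (\<Sum>k<N. c k * cis (2 * pi * real l / real N) ^ k))\<^sup>2) = real N * (\<Sum>k<N. (norm (c k))\<^sup>2)"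
proof -
  define e where "e k = cis (2 * pi * real k / real N)" for k
  \<comment> \<open>The Fourier matrix is symmetric: powers indexed by k become powers indexed by l,
    and the orthogonality relation sums over l.\<close>
  have sw: "e l ^ k = e k ^ l" for k l
    by (simp add: e_def Complex.DeMoivre mult_ac)
  have trm: "(c k * e l ^ k) * cnj (c j * e l ^ j) = c k * cnj (c j) * (e k * cnj (e j)) ^ l" for k j l
    by (simp add: sw[of l k] sw[of l j] power_mult_distrib mult_ac)
  have "complex_of_real (\<Sum>l<N. (norm (\<Sum>k<N. c k * e l ^ k))\<^sup>2)
     = (\<Sum>l<N. (\<Sum>k<N. c k * e l ^ k) * cnj (\<Sum>j<N. c j * e l ^ j))"
    by (simp only: of_real_sum complex_norm_square)
  also have "\<dots> = (\<Sum>l<N. \<Sum>k<N. \<Sum>j<N. c k * cnj (c j) * (e k * cnj (e j)) ^ l)"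
    unfolding cnj_sum sum_product by (simp only: trm)
  also have "\<dots> = (\<Sum>k<N. \<Sum>j<N. c k * cnj (c j) * (\<Sum>l<N. (e k * cnj (e j)) ^ l))"
    unfolding sum_distrib_left by (subst sum.swap, rule sum.cong[OF refl], rule sum.swap)
  also have "\<dots> = (\<Sum>k<N. \<Sum>j<N. c k * cnj (c j) * (if j = k then of_nat N else 0))"
    unfolding e_def by (intro sum.cong refl) (simp add: sum_roots_unity_orthogonal)
  also have "\<dots> = (\<Sum>k<N. c k * cnj (c k) * of_nat N)"
    by (simp add: if_distrib cong: if_cong)
  also have "\<dots> = complex_of_real (real N * (\<Sum>k<N. (norm (c k))\<^sup>2))"
    by (simp add: sum_distrib_left mult_ac flip: complex_norm_square)
  finally show ?thesis unfolding e_def of_real_eq_iff .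
qed

text \<open>The kernel is a geometric sum of length \<open>N\<close> up to the factor \<open>1 / (1 - c ^ N)\<close>, so
  the orthogonality of the \<open>N\<close>-th roots of unity evaluates the sum.\<close>
lemma sum_kernel_roots_unity_le:
  fixes c :: complex
  assumes N: "0 < N" and c: "norm c \<le> 1 - 1 / real N"
  shows "(\<Sum>l<N. 1 / (norm (1 - c * cis (2 * pi * real l / real N)))\<^sup>2) \<le> 4 * (real N)\<^sup>2"
proof -
  define e where "e k = cis (2 * pi * real k / real N)" for k
  have eN: "e i ^ N = 1" for i
    using N cis_multiple_2pi[of "real i"] by (simp add: e_def Complex.DeMoivre)
  have c1: "norm c < 1" using c N by (smt (verit) divide_pos_pos of_nat_0_less_iff)
  \<comment> \<open>The distance of c from the unit circle is just enough to keep
    \<open>c ^ N\<close> below 1/e, hence \<open>1 - c ^ N\<close> away from 0; the factor 4 of the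
    statement is the inverse square of 1/2.\<close>
  have "norm (c ^ N) \<le> (1 - 1 / real N) ^ N" using c by (simp add: norm_power power_mono)
  also have "\<dots> \<le> exp (- 1 / real N) ^ N"
    using N exp_ge_add_one_self[of "- 1 / real N"] by (intro power_mono) auto
  also have "\<dots> = exp (- 1)" using N by (simp flip: exp_of_nat_mult)
  also have "\<dots> \<le> 1 / 2" using exp_ge_add_one_self[of 1] by (simp add: exp_minus field_simps)
  finally have cN: "1 / 2 \<le> norm (1 - c ^ N)"
    using norm_triangle_ineq2[of 1 "c ^ N"] by simp
  have "1 / (norm (1 - c * e l))\<^sup>2 \<le> 4 * (norm (\<Sum>k<N. c ^ k * e l ^ k))\<^sup>2" for l
  proof -
    have ne: "norm (c * e l) < 1" using c1 by (simp add: norm_mult e_def)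
    then have nz: "1 - c * e l \<noteq> 0" by auto
    have "(1 - c * e l) * (\<Sum>k<N. c ^ k * e l ^ k) = 1 - c ^ N"
      using one_diff_power_eq[of "c * e l" N] eN by (simp add: power_mult_distrib)
    then have "1 / 2 \<le> norm (1 - c * e l) * norm (\<Sum>k<N. c ^ k * e l ^ k)"
      using cN by (metis norm_mult)
    from power_mono[OF this, of 2]
    have "1 / 4 \<le> (norm (1 - c * e l))\<^sup>2 * (norm (\<Sum>k<N. c ^ k * e l ^ k))\<^sup>2"
      by (simp add: power_mult_distrib power_one_over)
    moreover have "0 < (norm (1 - c * e l))\<^sup>2" using nz by simp
    ultimately show ?thesis by (simp only: pos_divide_le_eq) (simp add: mult_ac)
  qed
  then have "(\<Sum>l<N. 1 / (norm (1 - c * e l))\<^sup>2) \<le> (\<Sum>l<N. 4 * (norm (\<Sum>k<N. c ^ k * e l ^ k))\<^sup>2)"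
    by (intro sum_mono)
  also have "\<dots> = 4 * (real N * (\<Sum>k<N. (norm (c ^ k))\<^sup>2))"
    unfolding e_def sum_distrib_left[symmetric] sum_roots_unity_Parseval ..
  also have "\<dots> \<le> 4 * (real N * (\<Sum>k<N. 1))"
    using c1 by (intro mult_left_mono sum_mono) (auto simp: norm_power power_le_one)
  finally show ?thesis by (simp add: e_def power2_eq_square)
qed

section \<open>Rotation invariance of planar Lebesgue measure, and polar coordinates\<close>

text \<open>Lebesgue measure of the plane is the image of the product measure because both give a
  box the product of its side lengths. With coordinates at hand, a shear is a translation in one
  variable.\<close>

lemma nn_integral_complex_Fubini:
  assumes [measurable]: "f \<in> borel_measurable borel"
  shows "(\<integral>\<^sup>+z. f z \<partial>lborel) = (\<integral>\<^sup>+x. \<integral>\<^sup>+y. f (Complex x y) \<partial>lborel \<partial>lborel)"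
proof -
  have M [measurable]: "(\<lambda>(x, y). Complex x y) \<in> borel \<Otimes>\<^sub>M borel \<rightarrow>\<^sub>M borel"
    unfolding borel_prod by (intro borel_measurable_continuous_onI)
      (auto simp: case_prod_unfold Complex_eq intro!: continuous_intros)
  define M where "M = distr (lborel \<Otimes>\<^sub>M lborel) borel (\<lambda>(x, y). Complex x y)"
  have "lborel = M"
  proof (rule lborel_eqI)
    fix l u :: complex assume lu: "\<And>b. b \<in> Basis \<Longrightarrow> l \<bullet> b \<le> u \<bullet> b"
    have "(\<lambda>(x, y). Complex x y) -` box l u \<inter> space (lborel \<Otimes>\<^sub>M lborel) = box (Re l) (Re u) \<times> box (Im l) (Im u)"
      by (auto simp: box_def Basis_complex_def space_pair_measure)
    then have "emeasure M (box l u) = emeasure (lborel \<Otimes>\<^sub>M lborel) (box (Re l) (Re u) \<times> box (Im l) (Im u))"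
      by (simp add: M_def emeasure_distr)
    also have "\<dots> = ennreal (Re u - Re l) * ennreal (Im u - Im l)"
      using lu[of 1] lu[of \<i>] by (subst lborel.emeasure_pair_measure_Times) (auto simp: Basis_complex_def)
    also have "\<dots> = ennreal (\<Prod>b\<in>Basis. (u - l) \<bullet> b)"
      using lu[of 1] lu[of \<i>] by (simp add: Basis_complex_def ennreal_mult)
    finally show "emeasure M (box l u) = ennreal (\<Prod>b\<in>Basis. (u - l) \<bullet> b)" .
  qed (simp add: M_def)
  then have "(\<integral>\<^sup>+z. f z \<partial>lborel) = (\<integral>\<^sup>+z. f z \<partial>M)" by simp
  also have "\<dots> = (\<integral>\<^sup>+z. f (case z of (x, y) \<Rightarrow> Complex x y) \<partial>(lborel \<Otimes>\<^sub>M lborel))"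
    unfolding M_def by (subst nn_integral_distr) auto
  also have "\<dots> = (\<integral>\<^sup>+x. \<integral>\<^sup>+y. f (Complex x y) \<partial>lborel \<partial>lborel)"
    by (subst lborel.nn_integral_fst[symmetric]) auto
  finally show ?thesis .
qed

lemma borel_measurable_Complex [measurable]:
  "(\<lambda>x. Complex (f x) (g x)) \<in> borel_measurable M"
  if "f \<in> borel_measurable M" "g \<in> borel_measurable M"
  using that unfolding Complex_eq by measurable

lemma nn_integral_complex_Fubini':
  assumes [measurable]: "f \<in> borel_measurable borel"
  shows "(\<integral>\<^sup>+z. f z \<partial>lborel) = (\<integral>\<^sup>+y. \<integral>\<^sup>+x. f (Complex x y) \<partial>lborel \<partial>lborel)"
  unfolding nn_integral_complex_Fubini[OF assms]
  by (rule lborel_pair.Fubini') measurable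

lemma nn_integral_real_shift:
  fixes t :: real
  assumes "f \<in> borel_measurable borel"
  shows "(\<integral>\<^sup>+x. f (x + t) \<partial>lborel) = (\<integral>\<^sup>+x. f x \<partial>lborel)"
  using nn_integral_real_affine[OF assms, of 1 t] by (simp add: add.commute)

lemma nn_integral_complex_shear_Re:
  fixes t :: real
  assumes [measurable]: "f \<in> borel_measurable borel"
  shows "(\<integral>\<^sup>+z. f (Complex (Re z + t * Im z) (Im z)) \<partial>lborel) = (\<integral>\<^sup>+z. f z \<partial>lborel)"
  by (simp add: nn_integral_complex_Fubini' nn_integral_real_shift[of "\<lambda>x. f (Complex x _)"])

lemma nn_integral_complex_shear_Im:
  fixes t :: real
  assumes [measurable]: "f \<in> borel_measurable borel"
  shows "(\<integral>\<^sup>+z. f (Complex (Re z) (Im z + t * Re z)) \<partial>lborel) = (\<integral>\<^sup>+z. f z \<partial>lborel)"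
  by (simp add: nn_integral_complex_Fubini nn_integral_real_shift[of "\<lambda>y. f (Complex _ y)"])

text \<open>A rotation that is not real is a product of three shears; a real one is a product of two
  rotations that are not real.\<close>
lemma nn_integral_complex_rotate:
  fixes c :: complex
  assumes f [measurable]: "f \<in> borel_measurable borel" and c: "norm c = 1"
  shows "(\<integral>\<^sup>+z. f (c * z) \<partial>lborel) = (\<integral>\<^sup>+z. f z \<partial>lborel)"
proof -
  have *: "(\<integral>\<^sup>+z. f (c * z) \<partial>lborel) = (\<integral>\<^sup>+z. f z \<partial>lborel)"
    if [measurable]: "f \<in> borel_measurable borel" and c: "norm c = 1" "Im c \<noteq> 0" for f and c :: complex
  proof -
    \<comment> \<open>For c = cis \<theta> this t is - tan(\<theta> / 2); the rotation factors into
      shears with the parameters t, s, t.\<close>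
    define s t where "s = Im c" and "t = (Re c - 1) / s"
    have cc: "Re c * Re c + s * s = 1" using c by (simp add: s_def cmod_def power2_eq_square)
    have st: "s * t = Re c - 1" "s \<noteq> 0" using c by (auto simp: s_def t_def)
    have "(Re c - 1) * (1 + Re c) = - (s * s)" using cc by (simp add: algebra_simps)
    then have "t * (1 + Re c) = - s" using st(2) by (simp add: t_def)
    then have t2: "t + t * Re c = - s" by (simp add: algebra_simps)
    define h where "h z = Complex (Re z + t * Im z) (Im z)" for z
    define k where "k z = Complex (Re z) (Im z + s * Re z)" for z
    have [measurable]: "h \<in> borel_measurable borel" "k \<in> borel_measurable borel"
      unfolding h_def k_def by measurable
    have "h (k (h z)) = c * z" for z
    proof -
      have "Re (h (k (h z))) = (1 + s * t) * Re z + (t + t * (1 + s * t)) * Im z" 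
        by (simp add: h_def k_def algebra_simps)
      also have "\<dots> = Re (c * z)" unfolding st(1) using t2 by (simp add: s_def)
      finally have 1: "Re (h (k (h z))) = Re (c * z)" .
      have "Im (h (k (h z))) = s * Re z + (1 + s * t) * Im z" 
        by (simp add: h_def k_def algebra_simps)
      also have "\<dots> = Im (c * z)" unfolding st(1) by (simp add: s_def)
      finally show ?thesis using 1 by (simp add: complex_eq_iff)
    qed
    then have "(\<integral>\<^sup>+z. f (c * z) \<partial>lborel) = (\<integral>\<^sup>+z. f (h (k (h z))) \<partial>lborel)" by simp
    also have "\<dots> = (\<integral>\<^sup>+z. f (h (k z)) \<partial>lborel)"
      using nn_integral_complex_shear_Re[of "\<lambda>z. f (h (k z))" t] by (simp add: h_def)
    also have "\<dots> = (\<integral>\<^sup>+z. f (h z) \<partial>lborel)"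
      using nn_integral_complex_shear_Im[of "\<lambda>z. f (h z)" s] by (simp add: k_def)
    also have "\<dots> = (\<integral>\<^sup>+z. f z \<partial>lborel)"
      using nn_integral_complex_shear_Re[of f t] by (simp add: h_def)
    finally show ?thesis .
  qed
  show ?thesis
  proof (cases "Im c = 0")
    case True
    then have "Re c \<noteq> 0" using c by (auto simp: cmod_def)
    have "(\<integral>\<^sup>+z. f (c * z) \<partial>lborel) = (\<integral>\<^sup>+z. f (- c * \<i> * (\<i> * z)) \<partial>lborel)"
      by (intro nn_integral_cong arg_cong[of _ _ f]) (simp add: complex_eq_iff)
    also have "\<dots> = (\<integral>\<^sup>+z. f (- c * \<i> * z) \<partial>lborel)"
      by (rule *) auto
    also have "\<dots> = (\<integral>\<^sup>+z. f z \<partial>lborel)"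
      using \<open>Re c \<noteq> 0\<close> c by (intro *) (auto simp: norm_mult)
    finally show ?thesis .
  qed (use * f c in blast)
qed

text \<open>The image of the area of the disc under \<open>norm\<close> and the density 2 pi r on
  [0, 1) agree on every half-line above x: both give pi (1 - x^2), with x clamped to [0, 1]. The
  first comes from areas of discs, the second from an antiderivative.\<close>

lemma nn_integral_radial_unit_disc:
  fixes h :: "real \<Rightarrow> ennreal"
  assumes [measurable]: "h \<in> borel_measurable borel"
  shows "(\<integral>\<^sup>+z. indicator (ball 0 1) z * h (norm (z::complex)) \<partial>lborel)
       = (\<integral>\<^sup>+r. indicator {0..<1} r * (ennreal (2 * pi * r) * h r) \<partial>lborel)"
proof -
  have [simp]: "(indicator (ball 0 1) :: complex \<Rightarrow> ennreal) \<in> borel_measurable borel"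
    by (rule borel_measurable_indicator) simp
  define M where "M = distr (density lborel (indicator (ball 0 1))) borel (norm :: complex \<Rightarrow> real)"
  define N where "N = density lborel (\<lambda>r. indicator {0..<1} r * ennreal (2 * pi * r))"
  have "M = N"
  proof (rule measure_eqI_lessThan)
    fix x :: real
    have "emeasure M {x<..} = emeasure lborel (ball 0 1 \<inter> {z::complex. x < norm z})"
      unfolding M_def
      by (subst emeasure_distr, simp, simp, subst emeasure_density, measurable)
         (auto simp: vimage_def simp flip: nn_integral_indicator indicator_inter_arith intro!: nn_integral_cong)
    also have "\<dots> = ennreal (pi * (1 - (max 0 (min x 1))\<^sup>2))"
    proof -
      consider "x < 0" | "0 \<le> x" "x < 1" | "1 \<le> x" by linarith
      then show ?thesis
      proof cases
        case 1
        then have "ball 0 1 \<inter> {z::complex. x < norm z} = ball 0 1"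
          by (auto intro: less_le_trans[OF _ norm_ge_zero])
        then show ?thesis using 1 emeasure_ball[of 1 "0::complex"] by (simp add: unit_ball_vol_2)
      next
        case 2
        have "ball 0 1 \<inter> {z::complex. x < norm z} = ball 0 1 - cball 0 x" by auto
        moreover have "emeasure lborel (ball 0 1 - cball 0 x :: complex set)
            = emeasure lborel (ball 0 1 :: complex set) - emeasure lborel (cball 0 x :: complex set)"
          using 2 by (intro emeasure_Diff) (auto simp: emeasure_cball)
        ultimately show ?thesis using 2
          by (simp add: emeasure_ball emeasure_cball unit_ball_vol_2 ennreal_minus right_diff_distrib)
      next
        case 3
        then have "ball 0 1 \<inter> {z::complex. x < norm z} = {}" by auto
        then show ?thesis using 3 by simp
      qed
    qed
    finally have 1: "emeasure M {x<..} = ennreal (pi * (1 - (max 0 (min x 1))\<^sup>2))" .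
    have "emeasure N {x<..} = (\<integral>\<^sup>+r. ennreal (2 * pi * r) * indicator {max 0 (min x 1)..1} r \<partial>lborel)"
    proof -
      have "AE r in lborel. indicator {0..<1} r * ennreal (2 * pi * r) * indicator {x<..} r
          = ennreal (2 * pi * r) * indicator {max 0 (min x 1)..1} r"
        using AE_lborel_singleton[of 1] AE_lborel_singleton[of x]
        by eventually_elim (auto simp: indicator_def)
      then show ?thesis
        unfolding N_def by (subst emeasure_density) (auto intro: nn_integral_cong_AE)
    qed
    also have "\<dots> = ennreal (pi * 1\<^sup>2 - pi * (max 0 (min x 1))\<^sup>2)"
      by (rule nn_integral_FTC_Icc) (auto intro!: derivative_eq_intros)
    finally show "emeasure M {x<..} = emeasure N {x<..}" using 1 by (simp add: algebra_simps)
    show "emeasure M {x<..} < \<infinity>" using 1 by simp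
  qed (auto simp: M_def N_def)
  have "(\<integral>\<^sup>+z. indicator (ball 0 1) z * h (norm (z::complex)) \<partial>lborel) = (\<integral>\<^sup>+r. h r \<partial>M)"
    unfolding M_def by (subst nn_integral_distr, simp, simp, subst nn_integral_density, auto)
  also have "\<dots> = (\<integral>\<^sup>+r. h r \<partial>N)" by (simp add: \<open>M = N\<close>)
  also have "\<dots> = (\<integral>\<^sup>+r. indicator {0..<1} r * (ennreal (2 * pi * r) * h r) \<partial>lborel)"
    unfolding N_def by (subst nn_integral_density) (auto simp: mult.assoc)
  finally show ?thesis .
qed

section \<open>Nodes and kernels\<close>

text \<open>Half-open in the distance to the boundary, so that the levels partition the unit disc;
  level 0 is a full disc about 0.\<close>

definition annulus :: "nat \<Rightarrow> nat \<Rightarrow> complex set" where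
  "annulus B n = {z. 1 - 1 / real B ^ n \<le> norm z \<and> norm z < 1 - 1 / real B ^ Suc n}"

text \<open>The \<open>B ^ n\<close> points of level n have angular spacing comparable with their
  distance \<open>1 / B ^ n\<close> to the boundary, so they form a hyperbolic lattice. Level 0
  consists of the point 0 alone.\<close>

definition node :: "nat \<Rightarrow> nat \<Rightarrow> nat \<Rightarrow> complex" where
  "node B n l = of_real (1 - 1 / real B ^ n) * cis (2 * pi * real l / real B ^ n)"

text \<open>Normalised to have modulus at most 1 on the disc and to be bounded below near a; for a =
  0 it is the constant 1.\<close>

definition kern :: "complex \<Rightarrow> complex \<Rightarrow> complex" where
  "kern a z = of_real (1 - norm a) / (1 - cnj a * z)"

text \<open>The nodes of the first N levels only: a finite set, over which all choices of signs can
  be averaged.\<close>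

definition idx :: "nat \<Rightarrow> nat \<Rightarrow> (nat \<times> nat) set" where
  "idx B N = (SIGMA n:{..<N}. {..<B ^ n})"

lemma finite_idx [simp]: "finite (idx B N)" by (simp add: idx_def)

lemma annulus_in_borel [measurable, simp]: "annulus B n \<in> sets borel"
  unfolding annulus_def by measurable

lemma kern_measurable [measurable]: "kern a \<in> borel_measurable borel"
  unfolding kern_def by measurable

lemma annulus_subset: "annulus B n \<subseteq> ball 0 1"
proof
  fix z assume "z \<in> annulus B n"
  moreover have "0 \<le> 1 / real B ^ Suc n" by simp
  ultimately show "z \<in> ball 0 1" unfolding annulus_def mem_Collect_eq mem_ball_0 by linarith
qed

lemma annulus_norm_less_1: "z \<in> annulus B n \<Longrightarrow> norm z < 1"
  using annulus_subset by force

lemma annulus_rotate: "norm c = 1 \<Longrightarrow> c * z \<in> annulus B n \<longleftrightarrow> z \<in> annulus B n"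
  by (simp add: annulus_def norm_mult)

lemma kern_rotate:
  assumes "norm c = 1"
  shows "kern (c * a) (c * z) = kern a z"
proof -
  have "cnj c * c = 1" using assms by (metis complex_mod_mult_cnj complex_norm_square mult.commute of_real_1 power_one)
  then have "cnj (c * a) * (c * z) = cnj a * z" by (simp add: algebra_simps)
  then show ?thesis unfolding kern_def using assms by (simp add: norm_mult)
qed

lemma norm_one_minus_cnj_mult_ge:
  assumes "norm a \<le> 1" "norm z \<le> 1"
  shows "1 - norm a \<le> norm (1 - cnj a * z)" "1 - norm z \<le> norm (1 - cnj a * z)"
proof -
  have "1 - norm a * norm z \<le> norm (1 - cnj a * z)"
    using norm_triangle_ineq2[of 1 "cnj a * z"] by (simp add: norm_mult)
  moreover have "norm a * norm z \<le> norm a" "norm a * norm z \<le> norm z"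
    using assms by (auto intro: mult_left_le mult_left_le_one_le)
  ultimately show "1 - norm a \<le> norm (1 - cnj a * z)" "1 - norm z \<le> norm (1 - cnj a * z)" by auto
qed

lemma norm_kern: "norm a \<le> 1 \<Longrightarrow> norm (kern a z) = (1 - norm a) / norm (1 - cnj a * z)"
  by (simp add: kern_def norm_divide del: of_real_diff)

lemma norm_kern_le_1:
  assumes "norm a \<le> 1" "norm z \<le> 1"
  shows "norm (kern a z) \<le> 1"
  using norm_one_minus_cnj_mult_ge[OF assms] assms
  by (auto simp: norm_kern divide_le_eq_1)

lemma one_over_power_le_1: "2 \<le> B \<Longrightarrow> 1 / real B ^ n \<le> 1" by simp

lemma norm_node: "2 \<le> B \<Longrightarrow> norm (node B n l) = 1 - 1 / real B ^ n"
  using one_over_power_le_1[of B n] by (simp add: node_def norm_mult del: of_real_diff)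

lemma norm_node_le_1: "2 \<le> B \<Longrightarrow> norm (node B n l) \<le> 1"
  by (simp add: norm_node)

text \<open>Up to conjugation, the denominators are those of
  \<open>sum_kernel_roots_unity_le\<close> with c = (1 - 1/N) cnj z and N = \<open>B ^ n\<close>;
  the squared numerators \<open>1 / N\<^sup>2\<close> cancel its bound
  \<open>4 * N\<^sup>2\<close>.\<close>

lemma sum_norm_kern_node_le:
  assumes B: "2 \<le> B" and z: "norm z < 1"
  shows "(\<Sum>l<B ^ n. (norm (kern (node B n l) z))\<^sup>2) \<le> 4"
proof -
  define N where "N = B ^ n"
  define c where "c = of_real (1 - 1 / real N) * cnj z"
  have N: "0 < N" "real N = real B ^ n" using B by (auto simp: N_def)
  have N1: "0 \<le> 1 - 1 / real N" using N(1) by simp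
  have "norm c = (1 - 1 / real N) * norm z" using N1 by (simp add: c_def norm_mult del: of_real_diff)
  also have "\<dots> \<le> 1 - 1 / real N" using N1 z by (simp add: mult_left_le)
  finally have c: "norm c \<le> 1 - 1 / real N" .
  have "(norm (kern (node B n l) z))\<^sup>2 = 1 / (real N)\<^sup>2 * (1 / (norm (1 - c * cis (2 * pi * real l / real N)))\<^sup>2)" for l
  proof -
    have "cnj (1 - cnj (node B n l) * z) = 1 - c * cis (2 * pi * real l / real N)"
      by (simp add: node_def c_def N(2) mult_ac)
    then have "norm (1 - cnj (node B n l) * z) = norm (1 - c * cis (2 * pi * real l / real N))"
      by (metis complex_mod_cnj)
    then show ?thesis
      using norm_node[OF B, of n l] by (simp add: norm_kern power_divide power_mult_distrib N(2))
  qed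
  then have "(\<Sum>l<N. (norm (kern (node B n l) z))\<^sup>2)
      = 1 / (real N)\<^sup>2 * (\<Sum>l<N. 1 / (norm (1 - c * cis (2 * pi * real l / real N)))\<^sup>2)"
    by (simp add: sum_distrib_left)
  also have "\<dots> \<le> 1 / (real N)\<^sup>2 * (4 * (real N)\<^sup>2)"
    by (intro mult_left_mono sum_kernel_roots_unity_le N c) auto
  also have "\<dots> = 4" using N by simp
  finally show ?thesis by (simp add: N_def)
qed

text \<open>Rounding the argument down to a multiple of 2 pi / \<open>B ^ n\<close> moves the point
  by at most 7 / \<open>B ^ n\<close>, and the radius changes by at most 1 /
  \<open>B ^ n\<close>.\<close>

lemma exists_node_near:
  assumes B: "2 \<le> B" and z: "z \<in> annulus B n"
  obtains l where "l < B ^ n" "norm (z - node B n l) \<le> 8 / real B ^ n"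
proof -
  define N where "N = real B ^ n"
  have N: "0 < N" using B by (simp add: N_def)
  define t where "t = Arg2pi z"
  have t: "0 \<le> t" "t < 2 * pi" "z = of_real (norm z) * cis t"
    using Arg2pi[of z] by (auto simp: t_def cis_conv_exp is_Arg_def)
  define l where "l = nat \<lfloor>t * N / (2 * pi)\<rfloor>"
  have l0: "0 \<le> t * N / (2 * pi)" using t N by simp
  have l: "real l \<le> t * N / (2 * pi)" "t * N / (2 * pi) < real l + 1"
    using l0 by (auto simp: l_def)
  have "t * N / (2 * pi) < N" using t N by (simp add: divide_less_eq mult.commute)
  then have "l < B ^ n" using l by (metis N_def le_less_trans of_nat_less_iff of_nat_power)
  define s where "s = 2 * pi * real l / N"
  have ts: "\<bar>t - s\<bar> \<le> 2 * pi / N"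
  proof -
    have "s \<le> t" using l(1) N by (simp add: s_def field_simps)
    moreover have "t \<le> s + 2 * pi / N" using l(2) N by (simp add: s_def field_simps)
    ultimately show ?thesis by simp
  qed
  have "norm (cis t - cis s) \<le> \<bar>t - s\<bar>"
  proof -
    have "cis t - cis s = cis s * (cis (t - s) - 1)" by (simp add: algebra_simps cis_mult)
    then have "norm (cis t - cis s) = norm (cis (t - s) - 1)" by (simp add: norm_mult)
    also have "\<dots> \<le> \<bar>t - s\<bar>"
      using abs_sin_x_le_abs_x[of "(t - s) / 2"] by (simp add: cis_conv_exp dist_exp_i_1 del: of_real_diff)
    finally show ?thesis .
  qed
  also have "\<dots> \<le> 7 / N"
  proof -
    have "2 * pi / N \<le> 7 / N" using N pi_approx by (intro divide_right_mono) auto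
    then show ?thesis using ts by simp
  qed
  finally have cc: "norm (cis t - cis s) \<le> 7 / N" .
  have r: "norm z \<le> 1" "1 - 1 / N \<le> norm z"
    using z annulus_norm_less_1[OF z] by (auto simp: annulus_def N_def)
  have "z - node B n l = of_real (norm z) * (cis t - cis s) + of_real (norm z - (1 - 1 / N)) * cis s"
    using t(3) by (simp add: node_def s_def N_def algebra_simps)
  then have "norm (z - node B n l) \<le> norm z * norm (cis t - cis s) + \<bar>norm z - (1 - 1 / N)\<bar>"
    using norm_triangle_ineq[of "of_real (norm z) * (cis t - cis s)" "of_real (norm z - (1 - 1 / N)) * cis s"]
    by (simp add: norm_mult del: of_real_diff)
  also have "\<dots> \<le> 1 * (7 / N) + 1 / N" using r cc N by (intro add_mono mult_mono) auto
  finally show thesis using that[OF \<open>l < B ^ n\<close>] by (simp add: N_def)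
qed

text \<open>Expand around z = a, where the value is 1 - |a|^2. At a point within 8 (1 - |a|) of a
  this gives 10 (1 - |a|), the source of the tens below.\<close>

lemma norm_one_minus_cnj_le:
  assumes "norm a \<le> 1"
  shows "norm (1 - cnj a * z) \<le> 2 * (1 - norm a) + norm (z - a)"
proof -
  have "1 - cnj a * z = of_real (1 - (norm a)\<^sup>2) - cnj a * (z - a)"
    using complex_norm_square[of a] by (simp add: algebra_simps)
  then have "norm (1 - cnj a * z) \<le> \<bar>1 - (norm a)\<^sup>2\<bar> + norm a * norm (z - a)"
    using norm_triangle_ineq4[of "of_real (1 - (norm a)\<^sup>2)" "cnj a * (z - a)"]
    by (simp add: norm_mult del: of_real_diff of_real_power)
  moreover have "norm a * norm (z - a) \<le> norm (z - a)" using assms by (simp add: mult_left_le_one_le)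
  moreover have "1 - (norm a)\<^sup>2 = (1 - norm a) * (1 + norm a)" by (simp add: power2_eq_square algebra_simps)
  moreover have "(1 - norm a) * (1 + norm a) \<le> (1 - norm a) * 2" using assms by (intro mult_left_mono) auto
  moreover have "0 \<le> (1 - norm a) * (1 + norm a)" using assms by simp
  ultimately show ?thesis by linarith
qed

text \<open>With truncated subtraction the exponent is the distance of m and n, so the sum splits
  into two geometric ones.\<close>

lemma sum_power_dist_le:
  fixes t :: real
  assumes "0 \<le> t" "t < 1"
  shows "(\<Sum>n<N. t ^ ((m - n) + (n - m))) \<le> 2 / (1 - t)"
proof -
  have g: "(\<Sum>i<k. t ^ i) \<le> 1 / (1 - t)" for k
    using assms by (simp add: sum_gp_strict divide_right_mono)
  have "(\<Sum>n<N. t ^ ((m - n) + (n - m))) \<le> (\<Sum>n\<in>{..<m} \<union> {m..<m + N}. t ^ ((m - n) + (n - m)))"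
    using assms by (intro sum_mono2) auto
  also have "\<dots> = (\<Sum>n<m. t ^ (m - n)) + (\<Sum>n=m..<m + N. t ^ (n - m))"
    by (subst sum.union_disjoint) (auto intro!: arg_cong2[of _ _ _ _ "(+)"] sum.cong)
  also have "(\<Sum>n<m. t ^ (m - n)) = t * (\<Sum>i<m. t ^ i)"
    unfolding sum_distrib_left by (rule sum.reindex_bij_witness[of _ "\<lambda>i. m - Suc i" "\<lambda>i. m - Suc i"])
      (auto simp flip: power_Suc simp: Suc_diff_Suc)
  also have "t * (\<Sum>i<m. t ^ i) \<le> 1 * (\<Sum>i<m. t ^ i)" using assms by (intro mult_right_mono sum_nonneg) auto
  also have "(\<Sum>n=m..<m + N. t ^ (n - m)) = (\<Sum>i<N. t ^ i)"
    by (rule sum.reindex_bij_witness[of _ "\<lambda>i. i + m" "\<lambda>i. i - m"]) auto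
  finally show ?thesis using g[of m] g[of N] by simp
qed

text \<open>\<open>\<mu>\<close> stands for the measure \<open>\<omega> dA\<close> and \<open>W n\<close> for the tail integral of \<open>\<omega>\<close> from \<open>1 - B^(-n)\<close>.\<close>
locale radial_doubling_measure =
  fixes \<mu> :: "complex measure" and B :: nat and W :: "nat \<Rightarrow> real" and \<rho> D \<delta> :: real
  assumes B: "2 \<le> B"
    and sets_mu [simp, measurable_cong]: "sets \<mu> = sets borel"
    and finite_mu: "finite_measure \<mu>"
    and rotate: "\<And>c f. norm c = 1 \<Longrightarrow> f \<in> borel_measurable borel \<Longrightarrow> (\<integral>\<^sup>+z. f (c * z) \<partial>\<mu>) = (\<integral>\<^sup>+z. f z \<partial>\<mu>)"
    and AE_disc: "AE z in \<mu>. norm z < 1"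
    and W_pos: "\<And>n. 0 < W n"
    and rho: "0 < \<rho>" "\<rho> < 1" and W_Suc_le: "\<And>n. W (Suc n) \<le> \<rho> * W n"
    and D: "0 < D" and W_le_Suc: "\<And>n. W n \<le> D * W (Suc n)"
    and annulus_le: "\<And>n. emeasure \<mu> (annulus B n) \<le> ennreal (2 * W n)"
    and delta: "0 < \<delta>" and annulus_ge: "\<And>n. ennreal (\<delta> * W n) \<le> emeasure \<mu> (annulus B (n + 2))"
begin

sublocale finite_measure \<mu> by (rule finite_mu)

abbreviation X :: "nat \<Rightarrow> nat \<Rightarrow> complex \<Rightarrow> real" where
  "X n l z \<equiv> norm (kern (node B n l) z)"

lemma B_pos [simp]: "0 < B" "B \<noteq> 0" using B by auto

text \<open>By rotation invariance the integral does not depend on \<open>l\<close>, so it is the mean over all \<open>l\<close>.\<close>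
lemma nn_integral_annulus_kern2_le:
  assumes l: "l < B ^ n"
  shows "(\<integral>\<^sup>+z\<in>annulus B m. ennreal ((X n l z)\<^sup>2) \<partial>\<mu>) \<le> ennreal (4 / real B ^ n) * emeasure \<mu> (annulus B m)"
proof -
  define F where "F l = (\<integral>\<^sup>+z\<in>annulus B m. ennreal ((X n l z)\<^sup>2) \<partial>\<mu>)" for l
  have F0: "F l = F 0" for l
  proof -
    define c where "c = cis (2 * pi * real l / real B ^ n)"
    have c: "norm c = 1" by (simp add: c_def)
    have "node B n l = c * node B n 0" by (simp add: node_def c_def)
    then have "X n l (c * z) = X n 0 z" for z using kern_rotate[OF c] by simp
    then have "F 0 = (\<integral>\<^sup>+z. ennreal ((X n l (c * z))\<^sup>2) * indicator (annulus B m) (c * z) \<partial>\<mu>)"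
      by (simp add: F_def annulus_rotate[OF c] indicator_def)
    also have "\<dots> = F l" unfolding F_def by (rule rotate[OF c]) measurable
    finally show ?thesis by simp
  qed
  have "ennreal (real B ^ n) * F 0 = (\<Sum>l<B ^ n. F l)"
    using sum.cong[of "{..<B ^ n}" _ F "\<lambda>_. F 0"] F0 by (simp add: ennreal_of_nat_eq_real_of_nat)
  also have "\<dots> = (\<integral>\<^sup>+z. (\<Sum>l<B ^ n. ennreal ((X n l z)\<^sup>2) * indicator (annulus B m) z) \<partial>\<mu>)"
    unfolding F_def by (subst nn_integral_sum) auto
  also have "\<dots> \<le> (\<integral>\<^sup>+z. ennreal 4 * indicator (annulus B m) z \<partial>\<mu>)"
  proof (intro nn_integral_mono)
    fix z
    show "(\<Sum>l<B ^ n. ennreal ((X n l z)\<^sup>2) * indicator (annulus B m) z) \<le> ennreal 4 * indicator (annulus B m) z"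
    proof (cases "z \<in> annulus B m")
      case True
      then have "norm z < 1" using annulus_subset by force
      then show ?thesis using True sum_norm_kern_node_le[OF B, of z n]
        by (simp add: ennreal_le_iff flip: ennreal_numeral)
    qed simp
  qed
  also have "\<dots> = ennreal 4 * emeasure \<mu> (annulus B m)" by (rule nn_integral_cmult_indicator) simp
  finally have "ennreal (1 / real B ^ n) * (ennreal (real B ^ n) * F 0) \<le> ennreal (1 / real B ^ n) * (ennreal 4 * emeasure \<mu> (annulus B m))"
    by (rule mult_left_mono) simp
  moreover have "ennreal (1 / real B ^ n) * (ennreal (real B ^ n) * F 0) = F 0"
    by (simp flip: mult.assoc ennreal_mult'')
  moreover have "ennreal (1 / real B ^ n) * (ennreal 4 * emeasure \<mu> (annulus B m)) = ennreal (4 / real B ^ n) * emeasure \<mu> (annulus B m)"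
    by (subst mult.assoc[symmetric], subst ennreal_mult[symmetric]) auto
  ultimately show ?thesis using F0[of l] by (simp add: F_def)
qed

lemma W_add_le: "W (n + k) \<le> \<rho> ^ k * W n"
proof (induction k)
  case (Suc k)
  have "W (n + Suc k) \<le> \<rho> * W (n + k)" using W_Suc_le by simp
  also have "\<dots> \<le> \<rho> * (\<rho> ^ k * W n)" using Suc rho by (intro mult_left_mono) auto
  finally show ?case by (simp add: mult.assoc)
qed simp

lemma W_le_add: "W n \<le> D ^ k * W (n + k)"
proof (induction k)
  case (Suc k)
  have "D ^ k * W (n + k) \<le> D ^ k * (D * W (n + Suc k))" using W_le_Suc[of "n + k"] D by (intro mult_left_mono) auto
  then show ?case using Suc by (simp add: mult_ac)
qed simp

text \<open>One rate for both directions: \<open>\<rho>\<close> governs the decay of W outwards, and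
  1/2 bounds \<open>D / B ^ s\<close> inwards.\<close>

definition \<tau> where "\<tau> = max \<rho> (1 / 2)"

lemma tau: "0 < \<tau>" "\<tau> < 1" using rho by (auto simp: \<tau>_def)

text \<open>Two of the s + 2 powers go into the square estimate; the other s are bounded pointwise.
  Outwards (n <= m) they are at most 1 and \<open>W m\<close> itself decays. Inwards each level
  costs a factor D in W, but the kernel is at most \<open>B ^ (m + 1) / B ^ n\<close>, so each level
  gains \<open>B ^ s\<close>, at least 2 D; the extra + 1 in this exponent produces the constant
  \<open>B ^ s\<close>. The 8 is 4 from the square estimate times 2 from
  \<open>annulus_le\<close>.\<close>

lemma nn_integral_annulus_kern_le:
  assumes l: "l < B ^ n" and s: "2 * D \<le> real B ^ s"
  shows "(\<integral>\<^sup>+z\<in>annulus B m. ennreal (X n l z ^ (s + 2)) \<partial>\<mu>)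
      \<le> ennreal (8 * real B ^ s * \<tau> ^ ((m - n) + (n - m)) * (W n / real B ^ n))"
proof -
  define k where "k = (if n \<le> m then 1 else real B ^ (m + 1) / real B ^ n)"
  have k: "0 < k" by (simp add: k_def)
  have Xk: "X n l z \<le> k" if "z \<in> annulus B m" for z
  proof (cases "n \<le> m")
    case True
    have "norm z < 1" using that annulus_subset by force
    then show ?thesis using True norm_kern_le_1[OF norm_node_le_1[OF B]] by (simp add: k_def)
  next
    case False
    have z1: "norm z < 1" using that annulus_subset by force
    have z: "1 / real B ^ Suc m < 1 - norm z" using that by (simp add: annulus_def)
    also have "\<dots> \<le> norm (1 - cnj (node B n l) * z)"
      using norm_one_minus_cnj_mult_ge[OF norm_node_le_1[OF B], of z] z1 by simp
    finally have nb: "1 / real B ^ Suc m \<le> norm (1 - cnj (node B n l) * z)" by simp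
    then have "1 / real B ^ n / norm (1 - cnj (node B n l) * z) \<le> 1 / real B ^ n / (1 / real B ^ Suc m)"
      using less_le_trans[OF _ nb, of 0] by (intro divide_left_mono mult_pos_pos) auto
    then show ?thesis using False norm_node[OF B, of n l] by (simp add: k_def norm_kern)
  qed
  have "(\<integral>\<^sup>+z\<in>annulus B m. ennreal (X n l z ^ (s + 2)) \<partial>\<mu>)
     \<le> (\<integral>\<^sup>+z. ennreal (k ^ s) * (ennreal ((X n l z)\<^sup>2) * indicator (annulus B m) z) \<partial>\<mu>)"
    using Xk k by (intro nn_integral_mono)
       (auto simp: indicator_def power_add[of _ s 2] simp del: power_add_numeral2 add_2_eq_Suc'
             simp flip: ennreal_mult intro!: ennreal_leI mult_right_mono power_mono)
  also have "\<dots> = ennreal (k ^ s) * (\<integral>\<^sup>+z\<in>annulus B m. ennreal ((X n l z)\<^sup>2) \<partial>\<mu>)"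
    by (rule nn_integral_cmult) measurable
  also have "\<dots> \<le> ennreal (k ^ s) * (ennreal (4 / real B ^ n) * ennreal (2 * W m))"
    using order_trans[OF nn_integral_annulus_kern2_le[OF l] mult_left_mono[OF annulus_le[of m]]]
    by (intro mult_left_mono) auto
  also have "\<dots> = ennreal (8 * (k ^ s * W m) / real B ^ n)"
    using k W_pos[of m] by (simp flip: ennreal_mult add: field_simps)
  also have "\<dots> \<le> ennreal (8 * real B ^ s * \<tau> ^ ((m - n) + (n - m)) * (W n / real B ^ n))"
  proof -
    have "k ^ s * W m \<le> real B ^ s * \<tau> ^ ((m - n) + (n - m)) * W n"
    proof (cases "n \<le> m")
      case True
      then have "W m \<le> \<rho> ^ (m - n) * W n" using W_add_le[of n "m - n"] by simp
      also have "\<dots> \<le> \<tau> ^ (m - n) * W n" using rho W_pos[of n]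
        by (intro mult_right_mono power_mono) (auto simp: \<tau>_def)
      also have "\<dots> \<le> real B ^ s * (\<tau> ^ (m - n) * W n)"
        using mult_right_mono[of 1 "real B ^ s" "\<tau> ^ (m - n) * W n"] B tau W_pos[of n] by (simp add: less_imp_le)
      finally show ?thesis using True by (simp add: k_def mult.assoc)
    next
      case False
      define d where "d = n - m"
      have n: "n = m + d" using False by (simp add: d_def)
      have "k ^ s = real B ^ s / (real B ^ s) ^ d"
        using False unfolding k_def n
        by (simp add: power_add power_divide power_mult_distrib flip: power_mult) (simp add: mult.commute)
      moreover have "W m \<le> D ^ d * W n" using W_le_add[of m d] n by simp
      ultimately have "k ^ s * W m \<le> real B ^ s / (real B ^ s) ^ d * (D ^ d * W n)"
        using k by (metis mult_left_mono zero_less_power less_imp_le)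
      also have "\<dots> = real B ^ s * (D / real B ^ s) ^ d * W n" by (simp add: power_divide)
      also have "\<dots> \<le> real B ^ s * \<tau> ^ d * W n"
      proof (intro mult_right_mono mult_left_mono power_mono)
        have "D / real B ^ s \<le> 1 / 2" using s by (simp add: divide_le_eq)
        then show "D / real B ^ s \<le> \<tau>" unfolding \<tau>_def by (rule max.coboundedI2)
      qed (use D W_pos[of n] in auto)
      finally show ?thesis using n by simp
    qed
    then show ?thesis
      by (intro ennreal_leI) (simp add: mult.assoc divide_right_mono)
  qed
  finally show ?thesis .
qed

end

section \<open>Cauchy estimates on annuli and sampling at the nodes\<close>

text \<open>Hoelder's inequality for the measure with density g and mass at most a. A finite lower
  bound R stands in for the integral of f g, so that this integral may be infinite.\<close>

lemma nn_integral_weighted_powr_le: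
  fixes f g :: "'a \<Rightarrow> real"
  assumes p: "1 < p" and [measurable]: "f \<in> borel_measurable M" "g \<in> borel_measurable M"
    and f: "\<And>x. 0 \<le> f x" and g: "\<And>x. 0 \<le> g x"
    and a: "0 < a" "(\<integral>\<^sup>+x. ennreal (g x) \<partial>M) \<le> ennreal a"
    and R: "0 \<le> R" "ennreal R \<le> (\<integral>\<^sup>+x. ennreal (f x * g x) \<partial>M)"
  shows "ennreal (R powr p) \<le> ennreal (a powr (p - 1)) * (\<integral>\<^sup>+x. ennreal (f x powr p * g x) \<partial>M)"
proof (cases "R = 0 \<or> (\<integral>\<^sup>+x. ennreal (f x powr p * g x) \<partial>M) = \<infinity>")
  case True
  then show ?thesis using p a by (auto simp: ennreal_mult_top)
next
  case False
  then have R0: "0 < R" using R by auto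
  obtain i where i: "0 \<le> i" "(\<integral>\<^sup>+x. ennreal (f x powr p * g x) \<partial>M) = ennreal i"
    using False by (cases "(\<integral>\<^sup>+x. ennreal (f x powr p * g x) \<partial>M)") auto
  \<comment> \<open>Young's inequality at scale c gives x <= c^(1 - p) x^p / p + (1 - 1/p) c. With
    this c the last term integrates to at most (1 - 1/p) R, which the left-hand side
    absorbs.\<close>
  define c where "c = R / a"
  have c: "0 < c" using R0 a by (simp add: c_def)
  define q where "q = p / (p - 1)"
  have q: "1 < q" "1 / p + 1 / q = 1" "1 / q = 1 - 1 / p" using p by (auto simp: q_def field_simps)
  have young: "x \<le> c powr (1 - p) / p * x powr p + (1 - 1 / p) * c" if "0 \<le> x" for x
  proof -
    have "x / c * 1 \<le> (x / c) powr p / p + 1 powr q / q"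
      using that p q c by (intro Youngs_inequality) auto
    also have "\<dots> = x powr p / c powr p / p + (1 - 1 / p)" using that c q by (simp add: powr_divide)
    finally have "c * (x / c * 1) \<le> c * (x powr p / c powr p / p + (1 - 1 / p))"
      using c by (intro mult_left_mono) auto
    then show ?thesis using c by (simp add: powr_diff field_simps)
  qed
  have "ennreal R \<le> (\<integral>\<^sup>+x. ennreal (f x * g x) \<partial>M)" by (rule R)
  also have "\<dots> \<le> (\<integral>\<^sup>+x. ennreal (c powr (1 - p) / p) * ennreal (f x powr p * g x) + ennreal ((1 - 1 / p) * c) * ennreal (g x) \<partial>M)"
  proof (intro nn_integral_mono)
    fix x
    have "f x * g x \<le> (c powr (1 - p) / p * f x powr p + (1 - 1 / p) * c) * g x"
      using young[OF f] g by (intro mult_right_mono) auto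
    also have "\<dots> = (c powr (1 - p) / p) * (f x powr p * g x) + ((1 - 1 / p) * c) * g x" by (simp add: algebra_simps)
    finally show "ennreal (f x * g x) \<le> ennreal (c powr (1 - p) / p) * ennreal (f x powr p * g x) + ennreal ((1 - 1 / p) * c) * ennreal (g x)"
      using f[of x] g[of x] p c by (subst (1 2) ennreal_mult[symmetric], auto simp flip: ennreal_plus intro!: ennreal_leI)
  qed
  also have "\<dots> = ennreal (c powr (1 - p) / p) * ennreal i + ennreal ((1 - 1 / p) * c) * (\<integral>\<^sup>+x. ennreal (g x) \<partial>M)"
    by (simp add: nn_integral_add nn_integral_cmult i)
  also have "\<dots> \<le> ennreal (c powr (1 - p) / p) * ennreal i + ennreal ((1 - 1 / p) * c) * ennreal a"
    using a by (intro add_left_mono mult_left_mono) auto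
  also have "\<dots> = ennreal (c powr (1 - p) / p * i + (1 - 1 / p) * c * a)"
    using p c a i by (subst (1 2) ennreal_mult[symmetric], auto simp flip: ennreal_plus)
  finally have "R \<le> c powr (1 - p) / p * i + (1 - 1 / p) * c * a"
    using p c a i by (subst (asm) ennreal_le_iff) auto
  also have "\<dots> = c powr (1 - p) / p * i + R - R / p" using a by (simp add: c_def algebra_simps)
  finally have "R \<le> c powr (1 - p) * i" using p by (simp add: field_simps)
  then have "R powr (p - 1) * R \<le> R powr (p - 1) * (c powr (1 - p) * i)"
    by (intro mult_left_mono) auto
  moreover have "R powr (p - 1) * R = R powr p"
    using R0 powr_add[of R "p - 1" 1] by simp
  moreover have "c powr (1 - p) = a powr (p - 1) / R powr (p - 1)"
    using R0 a powr_minus_divide[of c "p - 1"] by (simp add: c_def powr_divide)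
  ultimately have "R powr p \<le> a powr (p - 1) * i" using R0 by simp
  then show ?thesis using i by (simp flip: ennreal_mult add: ennreal_leI)
qed

text \<open>Functions holomorphic on the disc have arbitrary values elsewhere; the cutoff makes them
  Borel on the whole plane.\<close>

lemma borel_measurable_norm_indicator:
  fixes f :: "'a::{second_countable_topology,topological_space} \<Rightarrow> 'b::real_normed_vector"
  assumes "continuous_on A f" "A \<in> sets borel"
  shows "(\<lambda>w. norm (f w) * indicator A w) \<in> borel_measurable borel"
proof -
  have "(\<lambda>w. indicator A w *\<^sub>R norm (f w)) \<in> borel_measurable borel"
    using assms by (intro borel_measurable_continuous_on_indicator continuous_intros) auto
  then show ?thesis by (simp add: mult.commute)
qed

lemma exists_annulus:
  assumes B: "2 \<le> B" and z: "norm z < 1"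
  obtains n where "z \<in> annulus B n"
proof -
  have "\<exists>n. norm z < 1 - 1 / real B ^ Suc n"
  proof -
    obtain n where "(1 / real B) ^ n < 1 - norm z"
      using real_arch_pow_inv[of "1 - norm z" "1 / real B"] B z by auto
    moreover have "1 / real B ^ Suc n \<le> 1 / real B ^ n"
      using B by (intro divide_left_mono) auto
    ultimately show ?thesis by (intro exI[of _ n]) (simp add: power_one_over)
  qed
  then have *: "norm z < 1 - 1 / real B ^ Suc (LEAST n. norm z < 1 - 1 / real B ^ Suc n)" (is "_ < 1 - 1 / _ ^ Suc ?n")
    by (rule LeastI_ex)
  have "1 - 1 / real B ^ ?n \<le> norm z"
  proof (cases ?n)
    case (Suc k)
    then have "\<not> norm z < 1 - 1 / real B ^ Suc k" by (intro not_less_Least) simp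
    then show ?thesis using Suc by simp
  qed simp
  then have "z \<in> annulus B ?n" using * by (simp add: annulus_def)
  then show thesis by (rule that)
qed

text \<open>Cauchy's formula on the circle through z, parametrised by rotations of z itself, which
  is the form to which rotation invariance of \<open>\<mu>\<close> applies. The proof first turns z
  onto the positive axis to match \<open>circlepath\<close>.\<close>

lemma holomorphic_le_circle_mean:
  assumes F: "F holomorphic_on ball 0 1" and z: "norm \<zeta> < norm z" "norm z < 1"
  shows "ennreal (norm (F \<zeta>)) \<le> (\<integral>\<^sup>+x\<in>{0..1}. ennreal (norm (F (cis (2 * pi * x) * z)) * norm z / norm (cis (2 * pi * x) * z - \<zeta>)) \<partial>lborel)"
proof -
  define r where "r = norm z"
  have r: "0 < r" "r < 1" using z by (auto simp: r_def intro: le_less_trans[OF norm_ge_zero])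
  define c where "c = z / of_real r"
  have c: "norm c = 1" "z = of_real r * c"
    using r by (auto simp: c_def r_def norm_divide)
  then have cc: "c * cnj c = 1" using complex_norm_square[of c] by simp
  define G where "G w = F (c * w)" for w
  have GF: "G holomorphic_on cball 0 r"
  proof -
    have "(F \<circ> (\<lambda>w. c * w)) holomorphic_on cball 0 r"
      using r c by (intro holomorphic_on_compose holomorphic_intros holomorphic_on_subset[OF F])
         (auto simp: norm_mult)
    then show ?thesis by (simp add: G_def[abs_def] o_def)
  qed
  define v where "v = cnj c * \<zeta>"
  have v: "norm (v - 0) < r" "c * v = \<zeta>" using c cc z r by (auto simp: v_def norm_mult r_def simp flip: mult.assoc)
  have dist: "norm (of_real r * cis t - v) = norm (cis t * z - \<zeta>)" for t
  proof -
    have "c * (of_real r * cis t - v) = cis t * z - \<zeta>" using c v by (simp add: algebra_simps)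
    then show ?thesis using c(1) by (metis mult_1 norm_mult)
  qed
  define h where "h x = G (of_real r * cis (2 * pi * x)) / (of_real r * cis (2 * pi * x) - v) * (2 * pi * \<i> * r * cis (2 * pi * x))" for x
  have "((\<lambda>x. G (circlepath 0 r x) / (circlepath 0 r x - v) * vector_derivative (circlepath 0 r) (at x within {0..1}))
      has_integral 2 * pi * \<i> * G v) {0..1}"
    using Cauchy_integral_circlepath_simple[OF GF v(1)] by (simp add: has_contour_integral_def)
  then have I: "(h has_integral 2 * pi * \<i> * G v) {0..1}"
  proof (rule has_integral_eq[rotated])
    fix x :: real assume "x \<in> {0..1}"
    then have "vector_derivative (circlepath 0 r) (at x within {0..1}) = 2 * pi * \<i> * r * cis (2 * pi * x)"
      by (simp add: vector_derivative_circlepath01 cis_conv_exp mult_ac)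
    moreover have "circlepath 0 r x = of_real r * cis (2 * pi * x)"
      by (simp add: circlepath cis_conv_exp mult_ac)
    ultimately show "G (circlepath 0 r x) / (circlepath 0 r x - v) * vector_derivative (circlepath 0 r) (at x within {0..1}) = h x"
      by (simp only: h_def)
  qed
  define g where "g x = norm (F (cis (2 * pi * x) * z)) * norm z / norm (cis (2 * pi * x) * z - \<zeta>)" for x
  have hg: "norm (h x) = 2 * pi * g x" for x
    using r c dist[of "2 * pi * x"] by (simp add: h_def g_def G_def norm_mult norm_divide mult_ac flip: r_def)
  have nz: "cis (2 * pi * x) * z - \<zeta> \<noteq> 0" for x
    using z by (metis eq_iff_diff_eq_0 less_irrefl mult_1 norm_cis norm_mult)
  have "continuous_on {0..1} g"
    unfolding g_def using z nz
    by (intro continuous_intros continuous_on_compose2[OF holomorphic_on_imp_continuous_on[OF F]])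
       (auto simp: norm_mult)
  then have gi: "g integrable_on {0..1}" by (rule integrable_continuous_interval)
  have "norm (integral {0..1} h) \<le> integral {0..1} (\<lambda>x. 2 * pi * g x)"
    using hg by (intro integral_norm_bound_integral has_integral_integrable[OF I]
        has_integral_integrable[OF has_integral_mult_right[OF integrable_integral[OF gi]]]) auto
  then have "2 * pi * norm (G v) \<le> 2 * pi * integral {0..1} g"
    using I by (simp add: integral_unique norm_mult)
  then have "norm (F \<zeta>) \<le> integral {0..1} g" using v by (simp add: G_def)
  then have "ennreal (norm (F \<zeta>)) \<le> ennreal (integral {0..1} g)" by (rule ennreal_leI)
  also have "\<dots> = (\<integral>\<^sup>+x\<in>{0..1}. ennreal (g x) \<partial>lborel)"
    by (rule nn_integral_has_integral_lebesgue'[OF _ integrable_integral[OF gi], symmetric]) (simp add: g_def)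
  finally show ?thesis by (simp add: g_def)
qed

context radial_doubling_measure begin

lemma nn_integral_le_suminf_annulus:
  assumes [measurable]: "f \<in> borel_measurable borel"
  shows "(\<integral>\<^sup>+z. f z \<partial>\<mu>) \<le> (\<Sum>m. \<integral>\<^sup>+z\<in>annulus B m. f z \<partial>\<mu>)"
proof -
  have "AE z in \<mu>. f z \<le> (\<Sum>m. f z * indicator (annulus B m) z)"
    using AE_disc
  proof eventually_elim
    case (elim z)
    obtain n where "z \<in> annulus B n" using exists_annulus[OF B elim] .
    then have "f z = (\<Sum>m\<in>{n}. f z * indicator (annulus B m) z)" by simp
    also have "\<dots> \<le> (\<Sum>m. f z * indicator (annulus B m) z)" by (rule sum_le_suminf) auto
    finally show ?case .
  qed
  then have "(\<integral>\<^sup>+z. f z \<partial>\<mu>) \<le> (\<integral>\<^sup>+z. (\<Sum>m. f z * indicator (annulus B m) z) \<partial>\<mu>)"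
    by (rule nn_integral_mono_AE)
  also have "\<dots> = (\<Sum>m. \<integral>\<^sup>+z\<in>annulus B m. f z \<partial>\<mu>)" by (rule nn_integral_suminf) measurable
  finally show ?thesis .
qed

lemma disjoint_family_annulus: "disjoint_family (annulus B)"
proof -
  have "annulus B m \<inter> annulus B n = {}" if "m < n" for m n
  proof -
    have "1 / real B ^ n \<le> 1 / real B ^ Suc m" 
      using that B by (intro divide_left_mono power_increasing) auto
    then show ?thesis unfolding annulus_def by (auto simp del: power_Suc)
  qed
  then show ?thesis unfolding disjoint_family_on_def by (metis inf_commute linorder_neqE_nat)
qed

text \<open>Integrate the circle bound over all z in the annulus and swap the integrals: by rotation
  invariance the inner integral no longer depends on the angle. Two levels of distance keep w away
  from \<zeta>.\<close>

lemma holomorphic_le_annulus_mean: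
  assumes F: "F holomorphic_on ball 0 1" and \<zeta>: "\<zeta> \<in> annulus B n"
  shows "ennreal (norm (F \<zeta>)) * emeasure \<mu> (annulus B (n + 2))
     \<le> (\<integral>\<^sup>+w\<in>annulus B (n + 2). ennreal (norm (F w) / norm (w - \<zeta>)) \<partial>\<mu>)"
proof -
  let ?A = "annulus B (n + 2)"
  define K where "K w = ennreal (norm (F w) / norm (w - \<zeta>)) * indicator ?A w" for w
  have [measurable]: "(\<lambda>w. norm (F w) * indicator ?A w) \<in> borel_measurable borel"
    using continuous_on_subset[OF holomorphic_on_imp_continuous_on[OF F] annulus_subset]
    by (rule borel_measurable_norm_indicator) simp
  have K: "K = (\<lambda>w. ennreal (norm (F w) * indicator ?A w / norm (w - \<zeta>)))"
    by (auto simp: K_def indicator_def)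
  have [measurable]: "K \<in> borel_measurable borel" unfolding K by measurable
  have lt: "norm \<zeta> < norm z" if "z \<in> ?A" for z
  proof -
    have "1 / real B ^ (n + 2) \<le> 1 / real B ^ Suc n"
      using B by (intro divide_left_mono power_increasing) auto
    then show ?thesis using \<zeta> that by (simp add: annulus_def del: power_Suc)
  qed
  interpret pair_sigma_finite \<mu> lborel
    by (intro pair_sigma_finite.intro sigma_finite_lborel) unfold_locales
  have cism [measurable]: "cis \<in> borel_measurable borel"
    by (intro borel_measurable_continuous_onI continuous_intros)
  have "ennreal (norm (F \<zeta>)) * emeasure \<mu> ?A = (\<integral>\<^sup>+z. ennreal (norm (F \<zeta>)) * indicator ?A z \<partial>\<mu>)"
    by (rule nn_integral_cmult_indicator[symmetric]) simp
  also have "\<dots> \<le> (\<integral>\<^sup>+z. (\<integral>\<^sup>+x\<in>{0..1}. K (cis (2 * pi * x) * z) \<partial>lborel) \<partial>\<mu>)"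
  proof (intro nn_integral_mono)
    fix z
    show "ennreal (norm (F \<zeta>)) * indicator ?A z \<le> (\<integral>\<^sup>+x\<in>{0..1}. K (cis (2 * pi * x) * z) \<partial>lborel)"
    proof (cases "z \<in> ?A")
      case True
      have "ennreal (norm (F \<zeta>)) \<le> (\<integral>\<^sup>+x\<in>{0..1}. ennreal (norm (F (cis (2 * pi * x) * z)) * norm z / norm (cis (2 * pi * x) * z - \<zeta>)) \<partial>lborel)"
        using True by (intro holomorphic_le_circle_mean F lt annulus_norm_less_1)
      also have "\<dots> \<le> (\<integral>\<^sup>+x\<in>{0..1}. K (cis (2 * pi * x) * z) \<partial>lborel)"
        using True annulus_norm_less_1[OF True]
        by (intro nn_integral_mono mult_right_mono)
           (auto simp: K_def annulus_rotate intro!: ennreal_leI divide_right_mono mult_left_le)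
      finally show ?thesis using True by simp
    qed simp
  qed
  also have "\<dots> = (\<integral>\<^sup>+x. (\<integral>\<^sup>+z. K (cis (2 * pi * x) * z) * indicator {0..1} x \<partial>\<mu>) \<partial>lborel)"
    by (rule Fubini'[symmetric]) measurable
  also have "\<dots> = (\<integral>\<^sup>+x. (\<integral>\<^sup>+z. K z \<partial>\<mu>) * indicator {0..1::real} x \<partial>lborel)"
    by (simp add: nn_integral_multc rotate)
  also have "\<dots> = (\<integral>\<^sup>+z. K z \<partial>\<mu>)" by (simp add: nn_integral_cmult_indicator)
  finally show ?thesis by (simp add: K_def)
qed

text \<open>Apply the mean value bound to \<open>f w / (1 - cnj a w)\<close> for the node \<open>a\<close>: the extra factor turns the
  Cauchy kernel into the square of the kernel of \<open>a\<close>.\<close>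
lemma sampling_inequality:
  assumes p: "1 < p"
  shows "\<exists>C>0. \<forall>f \<zeta> n l. f holomorphic_on ball 0 1 \<longrightarrow> \<zeta> \<in> annulus B n \<longrightarrow> l < B ^ n \<longrightarrow>
       norm (\<zeta> - node B n l) \<le> 8 / real B ^ n \<longrightarrow>
       ennreal (norm (f \<zeta>) powr p * (W n / real B ^ n))
         \<le> ennreal C * (\<integral>\<^sup>+w\<in>annulus B (n + 2). ennreal (norm (f w) powr p * (X n l w)\<^sup>2) \<partial>\<mu>)"
proof -
  \<comment> \<open>The product of 10, from the kernel denominator at \<zeta>, and 11 B^2, from its
    comparison with \<open>norm (w - \<zeta>)\<close>. In C, the 4 comes from the mass
    \<open>4 * m / N\<close> of the Hoelder weight and \<delta> from
    \<open>annulus_ge\<close>.\<close>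
  define E where "E = 110 * (real B)\<^sup>2"
  define C where "C = E powr p * 4 powr (p - 1) / \<delta>"
  have E: "0 < E" by (simp add: E_def)
  have C: "0 < C" using E delta by (simp add: C_def)
  show ?thesis
  proof (intro exI[of _ C] conjI allI impI C)
    fix f \<zeta> n l
    assume f: "f holomorphic_on ball 0 1" and \<zeta>: "\<zeta> \<in> annulus B n" and l: "l < B ^ n"
      and near: "norm (\<zeta> - node B n l) \<le> 8 / real B ^ n"
    let ?A = "annulus B (n + 2)"
    define N where "N = real B ^ n"
    have N: "0 < N" by (simp add: N_def)
    define a where "a = node B n l"
    have a: "norm a = 1 - 1 / N" "norm a \<le> 1" "1 - norm a = 1 / N" using norm_node[OF B, of n l] N by (auto simp: a_def N_def)
    have \<zeta>1: "norm \<zeta> < 1" using annulus_norm_less_1[OF \<zeta>] .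
    have za: "norm (1 - cnj a * \<zeta>) \<le> 10 / N"
      using norm_one_minus_cnj_le[OF a(2), of \<zeta>] near a by (simp add: a_def N_def)
    have nz: "1 - cnj a * w \<noteq> 0" if "norm w < 1" for w
      using norm_one_minus_cnj_mult_ge(1)[OF a(2), of w] that a N by (auto simp: field_simps)
    define F where "F w = f w / (1 - cnj a * w)" for w
    have F: "F holomorphic_on ball 0 1"
      unfolding F_def using nz by (intro holomorphic_intros f) auto
    define m where "m = measure \<mu> ?A"
    have m: "emeasure \<mu> ?A = ennreal m" by (simp add: m_def emeasure_eq_measure)
    have m\<delta>: "\<delta> * W n \<le> m" using annulus_ge[of n] unfolding m by (subst (asm) ennreal_le_iff) (auto simp: m_def)
    have m0: "0 < m" using m\<delta> delta W_pos[of n] by (smt (verit) mult_pos_pos)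
    \<comment> \<open>The gap of two levels makes \<open>norm (w - \<zeta>)\<close> at least
      \<open>1 / (B\<^sup>2 * N)\<close>, which also dominates the distance from \<zeta> to the
      node. Hence the Cauchy kernel is at most a multiple of
      \<open>1 / norm (1 - cnj a * w)\<close>, and F supplies the second such factor.\<close>
    have key: "norm (F w) / norm (w - \<zeta>) \<le> 11 * (real B)\<^sup>2 * N\<^sup>2 * (norm (f w) * (X n l w)\<^sup>2)" if w: "w \<in> ?A" for w
    proof -
      have w1: "norm w < 1" using annulus_norm_less_1[OF w] .
      have "1 / real B ^ Suc n - 1 / real B ^ (n + 2) \<le> norm w - norm \<zeta>"
        using w \<zeta> by (simp add: annulus_def del: power_Suc)
      also have "\<dots> \<le> norm (w - \<zeta>)" by (rule norm_triangle_ineq2)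
      also have "1 / real B ^ Suc n - 1 / real B ^ (n + 2) = (real B - 1) / (real B ^ 2 * N)"
        by (simp add: N_def power2_eq_square field_simps)
      finally have "(real B - 1) / (real B ^ 2 * N) \<le> norm (w - \<zeta>)" .
      moreover have "1 / (real B ^ 2 * N) \<le> (real B - 1) / (real B ^ 2 * N)"
        using B N by (intro divide_right_mono) auto
      ultimately have "1 / (real B ^ 2 * N) \<le> norm (w - \<zeta>)" by linarith
      then have d: "1 / N \<le> (real B)\<^sup>2 * norm (w - \<zeta>)" using N by (simp add: field_simps)
      have "norm (1 - cnj a * w) \<le> norm (1 - cnj a * \<zeta>) + norm (cnj a * (w - \<zeta>))"
        using norm_triangle_ineq4[of "1 - cnj a * \<zeta>" "cnj a * (w - \<zeta>)"] by (simp add: algebra_simps)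
      also have "\<dots> \<le> 10 / N + 1 * norm (w - \<zeta>)"
        using za a unfolding norm_mult by (intro add_mono mult_right_mono) auto
      also have "\<dots> \<le> 10 * ((real B)\<^sup>2 * norm (w - \<zeta>)) + (real B)\<^sup>2 * norm (w - \<zeta>)"
        using d B by (intro add_mono mult_right_mono) auto
      finally have b: "norm (1 - cnj a * w) \<le> 11 * (real B)\<^sup>2 * norm (w - \<zeta>)" by linarith
      have pos: "0 < norm (1 - cnj a * w)" using nz[OF w1] by simp
      then have dpos: "0 < norm (w - \<zeta>)" using b by (cases "w = \<zeta>") auto
      have "1 / norm (w - \<zeta>) \<le> 11 * (real B)\<^sup>2 / norm (1 - cnj a * w)"
        using b pos dpos by (simp add: divide_simps)
      then have "norm (F w) * (1 / norm (w - \<zeta>)) \<le> norm (F w) * (11 * (real B)\<^sup>2 / norm (1 - cnj a * w))"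
        by (intro mult_left_mono) auto
      also have "\<dots> = 11 * (real B)\<^sup>2 * N\<^sup>2 * (norm (f w) * (X n l w)\<^sup>2)"
        using N a pos unfolding a_def[symmetric]
        by (simp add: F_def norm_divide norm_kern power_divide power2_eq_square)
      finally show ?thesis by simp
    qed
    define g where "g w = (X n l w)\<^sup>2 * indicator ?A w" for w
    have fm [measurable]: "(\<lambda>w. norm (f w) * indicator ?A w) \<in> borel_measurable borel"
      using continuous_on_subset[OF holomorphic_on_imp_continuous_on[OF f] annulus_subset]
      by (rule borel_measurable_norm_indicator) simp
    have "ennreal (norm (F \<zeta>) * m) \<le> (\<integral>\<^sup>+w\<in>?A. ennreal (norm (F w) / norm (w - \<zeta>)) \<partial>\<mu>)"
      using holomorphic_le_annulus_mean[OF F \<zeta>] m m0 by (simp add: ennreal_mult)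
    also have "\<dots> \<le> (\<integral>\<^sup>+w. ennreal (11 * (real B)\<^sup>2 * N\<^sup>2) * ennreal (norm (f w) * indicator ?A w * g w) \<partial>\<mu>)"
      using key N by (intro nn_integral_mono) (auto simp: g_def indicator_def simp flip: ennreal_mult intro!: ennreal_leI)
    also have "\<dots> = ennreal (11 * (real B)\<^sup>2 * N\<^sup>2) * (\<integral>\<^sup>+w. ennreal (norm (f w) * indicator ?A w * g w) \<partial>\<mu>)"
      unfolding g_def by (rule nn_integral_cmult) measurable
    finally have 1: "ennreal (norm (F \<zeta>) * m) \<le> \<dots>" .
    \<comment> \<open>The mean value bound after division by its constant, with
      \<open>norm (F \<zeta>)\<close> replaced by its lower bound
      \<open>norm (f \<zeta>) * N / 10\<close>: a lower bound for the integral of |f| against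
      g.\<close>
    define R where "R = norm (f \<zeta>) * m / (E * N)"
    have R0: "0 \<le> R" using m0 E N by (simp add: R_def)
    have "norm (f \<zeta>) * N / 10 \<le> norm (F \<zeta>)"
    proof -
      have "0 < norm (1 - cnj a * \<zeta>)" using nz[OF \<zeta>1] by simp
      then have "norm (f \<zeta>) / (10 / N) \<le> norm (f \<zeta>) / norm (1 - cnj a * \<zeta>)"
        using za N by (intro divide_left_mono mult_pos_pos) auto
      then show ?thesis by (simp add: F_def norm_divide)
    qed
    then have "norm (f \<zeta>) * N / 10 * m \<le> norm (F \<zeta>) * m" using m0 by (intro mult_right_mono) auto
    then have "ennreal (1 / (11 * (real B)\<^sup>2 * N\<^sup>2)) * ennreal (norm (f \<zeta>) * N / 10 * m)
       \<le> ennreal (1 / (11 * (real B)\<^sup>2 * N\<^sup>2)) * (ennreal (11 * (real B)\<^sup>2 * N\<^sup>2) * (\<integral>\<^sup>+w. ennreal (norm (f w) * indicator ?A w * g w) \<partial>\<mu>))"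
      using order_trans[OF ennreal_leI 1] by (intro mult_left_mono) auto
    moreover have "ennreal (1 / (11 * (real B)\<^sup>2 * N\<^sup>2)) * ennreal (norm (f \<zeta>) * N / 10 * m) = ennreal R"
      using N m0 B by (simp add: R_def E_def power2_eq_square field_simps flip: ennreal_mult)
    moreover have "ennreal (1 / (11 * (real B)\<^sup>2 * N\<^sup>2)) * (ennreal (11 * (real B)\<^sup>2 * N\<^sup>2) * x) = x" for x
      using N B by (simp flip: mult.assoc ennreal_mult)
    ultimately have R: "ennreal R \<le> (\<integral>\<^sup>+w. ennreal (norm (f w) * indicator ?A w * g w) \<partial>\<mu>)" by simp
    have ga: "(\<integral>\<^sup>+w. ennreal (g w) \<partial>\<mu>) \<le> ennreal (4 * m / N)"
    proof -
      have "(\<integral>\<^sup>+w. ennreal (g w) \<partial>\<mu>) = (\<integral>\<^sup>+w\<in>?A. ennreal ((X n l w)\<^sup>2) \<partial>\<mu>)"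
        by (intro nn_integral_cong) (auto simp: g_def indicator_def)
      also have "\<dots> \<le> ennreal (4 / N) * ennreal m"
        using nn_integral_annulus_kern2_le[OF l, of "n + 2"] m by (simp add: N_def)
      finally show ?thesis using m0 N by (simp flip: ennreal_mult)
    qed
    have "(\<lambda>w. norm (f w) * indicator ?A w) \<in> borel_measurable \<mu>"
      by (subst measurable_cong_sets[OF sets_mu refl]) (rule fm)
    then have "ennreal (R powr p) \<le> ennreal ((4 * m / N) powr (p - 1)) * (\<integral>\<^sup>+w. ennreal ((norm (f w) * indicator ?A w) powr p * g w) \<partial>\<mu>)"
      by (rule nn_integral_weighted_powr_le[OF p _ _ _ _ _ ga R0 R]) (use  m0 N in \<open>auto simp: g_def\<close>)
    also have "(\<integral>\<^sup>+w. ennreal ((norm (f w) * indicator ?A w) powr p * g w) \<partial>\<mu>)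
        = (\<integral>\<^sup>+w\<in>?A. ennreal (norm (f w) powr p * (X n l w)\<^sup>2) \<partial>\<mu>)" (is "_ = ?I")
      by (intro nn_integral_cong) (auto simp: g_def indicator_def)
    finally have 2: "ennreal (R powr p) \<le> ennreal ((4 * m / N) powr (p - 1)) * ?I" .
    define c where "c = E powr p * N powr p / m powr p * (m / (\<delta> * N))"
    have c0: "0 \<le> c" using m0 N delta by (simp add: c_def)
    have "norm (f \<zeta>) powr p * (W n / N) \<le> norm (f \<zeta>) powr p * (m / (\<delta> * N))"
      using m\<delta> delta N by (intro mult_left_mono) (auto simp: field_simps)
    also have "\<dots> = c * R powr p"
      using m0 E N by (simp add: c_def R_def powr_mult powr_divide)
    finally have "ennreal (norm (f \<zeta>) powr p * (W n / N)) \<le> ennreal c * ennreal (R powr p)"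
      using c0 by (simp add: ennreal_leI flip: ennreal_mult)
    also have "\<dots> \<le> ennreal c * (ennreal ((4 * m / N) powr (p - 1)) * ?I)"
      by (intro mult_left_mono 2) auto
    also have "\<dots> = ennreal C * ?I"
    proof -
      have "c * (4 * m / N) powr (p - 1) = C"
        using m0 N E delta by (simp add: c_def C_def powr_mult powr_divide powr_diff field_simps)
      then show ?thesis using c0 by (simp flip: mult.assoc ennreal_mult)
    qed
    finally show "ennreal (norm (f \<zeta>) powr p * (W n / real B ^ n)) \<le> ennreal C * ?I" by (simp add: N_def)
  qed
qed

end

section \<open>Norm bounds for sums of kernels over all nodes\<close>

lemma powr_le_self: "0 \<le> x \<Longrightarrow> x \<le> 1 \<Longrightarrow> 1 \<le> p \<Longrightarrow> x powr p \<le> x" for x p :: real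
  using powr_mono'[of 1 p x] by simp

context radial_doubling_measure begin

lemma sum_idx: "(\<Sum>j\<in>idx B N. f j) = (\<Sum>n<N. \<Sum>l<B ^ n. f (n, l))"
  unfolding idx_def using sum.Sigma[of "{..<N}" "\<lambda>n. {..<B ^ n}" "\<lambda>n l. f (n, l)"] by simp

text \<open>Summed over all levels, the squares of the kernels diverge logarithmically at the boundary; the
  factor \<open>v powr (d / p)\<close>, with \<open>d\<close> the distance of levels, makes the weights of the Jensen inequality
  summable and is paid for by the geometric decay of the integrals over annuli.\<close>
lemma kernel_sum_powr_pointwise:
  fixes c :: "nat \<times> nat \<Rightarrow> real"
  assumes p: "1 < p" and v: "0 < v" "v < 1" and z: "norm z < 1" and k: "s + 4 \<le> k"
    and c: "\<And>j. j \<in> idx B N \<Longrightarrow> 0 \<le> c j"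
  shows "(\<Sum>(n, l)\<in>idx B N. c (n, l) * (W n / real B ^ n) powr (- 1 / p) * X n l z ^ k) powr p
    \<le> (8 / (1 - v powr (1 / p))) powr (p - 1)
        * (\<Sum>(n, l)\<in>idx B N. c (n, l) powr p / (W n / real B ^ n) / v ^ ((m - n) + (n - m)) * X n l z ^ (s + 2))"
proof -
  define t where "t = v powr (1 / p)"
  have t: "0 < t" "t < 1" "t powr p = v"
    using v p powr_less_mono2[of "1 / p" v 1] by (auto simp: t_def powr_powr)
  define d where "d n = (m - n) + (n - m)" for n
  define w where "w n = W n / real B ^ n" for n
  have w: "0 < w n" for n using W_pos[of n] by (simp add: w_def)
  have X1: "X n l z \<le> 1" for n l using norm_kern_le_1[OF norm_node_le_1[OF B]] z by simp
  \<comment> \<open>Two powers of the kernel and the level factor \<open>t ^ d n\<close> form the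
    Jensen weight b, whose sum is at most 4 * 2 / (1 - t). The remaining powers stay in a, and
    dividing by \<open>t ^ d n\<close> there becomes dividing by \<open>v ^ d n\<close> after the
    p-th power.\<close>
  define a where "a = (\<lambda>(n, l). c (n, l) * w n powr (- 1 / p) * X n l z ^ (k - 2) / t ^ d n)"
  define b where "b = (\<lambda>(n, l). (X n l z)\<^sup>2 * t ^ d n)"
  have a0: "0 \<le> a j" if "j \<in> idx B N" for j using c[OF that] t by (auto simp: a_def split: prod.split)
  have b0: "0 \<le> b j" for j using t by (auto simp: b_def split: prod.split)
  have "(\<Sum>j\<in>idx B N. a j * b j) powr p \<le> (\<Sum>j\<in>idx B N. b j) powr (p - 1) * (\<Sum>j\<in>idx B N. a j powr p * b j)"
    using p a0 b0 by (intro weighted_sum_powr_le) auto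
  also have "\<dots> \<le> (8 / (1 - t)) powr (p - 1) * (\<Sum>(n, l)\<in>idx B N. c (n, l) powr p / w n / v ^ d n * X n l z ^ (s + 2))"
  proof (intro mult_mono powr_mono2 sum_mono)
    have "(\<Sum>j\<in>idx B N. b j) = (\<Sum>n<N. t ^ d n * (\<Sum>l<B ^ n. (X n l z)\<^sup>2))"
      by (simp add: sum_idx b_def sum_distrib_left mult.commute)
    also have "\<dots> \<le> (\<Sum>n<N. t ^ d n * 4)"
      using t z by (intro sum_mono mult_left_mono sum_norm_kern_node_le B) auto
    also have "\<dots> \<le> 2 / (1 - t) * 4"
      unfolding sum_distrib_right[symmetric] d_def using t by (intro mult_right_mono sum_power_dist_le) auto
    finally show "(\<Sum>j\<in>idx B N. b j) \<le> 8 / (1 - t)" by simp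
    fix j assume j: "j \<in> idx B N"
    obtain n l where nl: "j = (n, l)" by (cases j)
    have cj: "0 \<le> c (n, l)" using c j nl by auto
    have "(t ^ d n) powr p = v ^ d n" using t by (metis powr_powr powr_realpow mult.commute powr_gt_zero)
    moreover have "(w n powr (- 1 / p)) powr p = 1 / w n" 
      using w[of n] p powr_minus_divide[of "w n" 1] by (simp add: powr_powr)
    ultimately have "a j powr p = c (n, l) powr p / w n / v ^ d n * (X n l z ^ (k - 2)) powr p"
      using cj t by (simp add: a_def nl powr_mult powr_divide)
    also have "\<dots> \<le> c (n, l) powr p / w n / v ^ d n * X n l z ^ (s + 2)"
    proof (intro mult_left_mono)
      \<comment> \<open>Since X is at most 1, higher powers may be lowered to s + 2, the exponent of
        the annulus estimate.\<close>
      have "(X n l z ^ (k - 2)) powr p \<le> X n l z ^ (k - 2)"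
        using X1 p by (intro powr_le_self power_le_one) auto
      also have "\<dots> \<le> X n l z ^ (s + 2)" using X1 k by (intro power_decreasing) auto
      finally show "(X n l z ^ (k - 2)) powr p \<le> X n l z ^ (s + 2)" .
    qed (use w[of n] v in auto)
    finally have "a j powr p * b j \<le> c (n, l) powr p / w n / v ^ d n * X n l z ^ (s + 2) * 1"
      using b0 t X1 w[of n] v by (intro mult_mono) (auto simp: b_def nl intro!: mult_le_one power_le_one)
    then show "a j powr p * b j \<le> (case j of (n, l) \<Rightarrow> c (n, l) powr p / w n / v ^ d n * X n l z ^ (s + 2))"
      by (simp add: nl)
  qed (use p b0 in \<open>auto intro!: sum_nonneg mult_nonneg_nonneg\<close>)
  also have "(\<Sum>j\<in>idx B N. a j * b j) = (\<Sum>(n, l)\<in>idx B N. c (n, l) * w n powr (- 1 / p) * X n l z ^ k)"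
  proof (intro sum.cong refl)
    fix j :: "nat \<times> nat"
    obtain n l where nl: "j = (n, l)" by (cases j)
    have "X n l z ^ k = X n l z ^ (k - 2) * (X n l z)\<^sup>2" 
      unfolding power_add[symmetric] using k by (intro arg_cong[of _ _ "power _"]) simp
    then show "a j * b j = (case j of (n, l) \<Rightarrow> c (n, l) * w n powr (- 1 / p) * X n l z ^ k)"
      using t by (simp add: a_def b_def nl)
  qed
  finally show ?thesis by (simp add: w_def d_def t_def)
qed

text \<open>The p-th power of \<open>(W n / B ^ n) powr (- 1 / p)\<close> cancels the mass
  \<open>W n / B ^ n\<close> of a kernel power of level n. It remains to sum the pointwise bound
  over all annuli; M depends on neither N nor k.\<close>

lemma kernel_sum_powr_le:
  assumes p: "1 < p" and s: "2 * D \<le> real B ^ s"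
  shows "\<exists>M>0. \<forall>N k (c :: nat \<times> nat \<Rightarrow> real). s + 4 \<le> k \<longrightarrow> (\<forall>j\<in>idx B N. 0 \<le> c j) \<longrightarrow>
       (\<integral>\<^sup>+z. ennreal ((\<Sum>(n, l)\<in>idx B N. c (n, l) * (W n / real B ^ n) powr (- 1 / p) * X n l z ^ k) powr p) \<partial>\<mu>)
        \<le> ennreal (M * (\<Sum>j\<in>idx B N. c j powr p))"
proof -
  \<comment> \<open>The annulus integrals decay like \<open>\<tau> ^ d\<close> in the distance d of
    levels. Half of this pays for the division by \<open>v ^ d\<close>, the other half is summable
    over the annuli.\<close>
  define v where "v = sqrt \<tau>"
  have v: "0 < v" "v < 1" "v * v = \<tau>" using tau by (auto simp: v_def)
  define Q where "Q = (8 / (1 - v powr (1 / p))) powr (p - 1)"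
  define K where "K = 8 * real B ^ s"
  define M where "M = Q * K * (2 / (1 - v))"
  have "v powr (1 / p) < 1" using v p powr_less_mono2[of "1 / p" v 1] by simp
  then have Q: "0 < Q" by (simp add: Q_def)
  have K: "0 < K" by (simp add: K_def)
  have M: "0 < M" using Q K v by (simp add: M_def)
  show ?thesis
  proof (intro exI[of _ M] conjI allI impI M)
    fix N k :: nat and c :: "nat \<times> nat \<Rightarrow> real"
    assume k: "s + 4 \<le> k" and c: "\<forall>j\<in>idx B N. 0 \<le> c j"
    define S where "S z = ennreal ((\<Sum>(n, l)\<in>idx B N. c (n, l) * (W n / real B ^ n) powr (- 1 / p) * X n l z ^ k) powr p)" for z
    have [measurable]: "S \<in> borel_measurable borel" unfolding S_def case_prod_unfold by measurable
    define e where "e m n = v ^ ((m - n) + (n - m))" for m n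
    have e: "0 < e m n" for m n using v by (simp add: e_def)
    have level: "(\<integral>\<^sup>+z\<in>annulus B m. S z \<partial>\<mu>) \<le> ennreal (Q * K * (\<Sum>(n, l)\<in>idx B N. c (n, l) powr p * e m n))" for m
    proof -
      define q where "q n l = Q * (c (n, l) powr p / (W n / real B ^ n) / e m n)" for n l
      have q0: "0 \<le> q n l" for n l using Q W_pos[of n] e[of m n] by (simp add: q_def)
      have "(\<integral>\<^sup>+z\<in>annulus B m. S z \<partial>\<mu>)
          \<le> (\<integral>\<^sup>+z. (\<Sum>(n, l)\<in>idx B N. ennreal (q n l) * (ennreal (X n l z ^ (s + 2)) * indicator (annulus B m) z)) \<partial>\<mu>)"
      proof (intro nn_integral_mono)
        fix z
        show "S z * indicator (annulus B m) z \<le> (\<Sum>(n, l)\<in>idx B N. ennreal (q n l) * (ennreal (X n l z ^ (s + 2)) * indicator (annulus B m) z))"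
        proof (cases "z \<in> annulus B m")
          case True
          then have z: "norm z < 1" by (rule annulus_norm_less_1)
          have "S z \<le> ennreal (\<Sum>(n, l)\<in>idx B N. q n l * X n l z ^ (s + 2))"
            unfolding S_def using kernel_sum_powr_pointwise[OF p v(1,2) z k, of N c m] c
            by (intro ennreal_leI) (simp add: q_def Q_def e_def sum_distrib_left case_prod_unfold mult.assoc)
          also have "\<dots> = (\<Sum>(n, l)\<in>idx B N. ennreal (q n l) * ennreal (X n l z ^ (s + 2)))"
            using q0 by (subst sum_ennreal[symmetric]) (auto simp: case_prod_unfold ennreal_mult)
          finally show ?thesis using True by simp
        qed simp
      qed
      also have "\<dots> = (\<Sum>(n, l)\<in>idx B N. ennreal (q n l) * (\<integral>\<^sup>+z\<in>annulus B m. ennreal (X n l z ^ (s + 2)) \<partial>\<mu>))"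
        by (simp add: case_prod_unfold nn_integral_sum nn_integral_cmult)
      also have "\<dots> \<le> (\<Sum>(n, l)\<in>idx B N. ennreal (Q * K * (c (n, l) powr p * e m n)))"
      proof (intro sum_mono, clarify)
        fix n l assume "(n, l) \<in> idx B N"
        then have l: "l < B ^ n" by (simp add: idx_def)
        have "ennreal (q n l) * (\<integral>\<^sup>+z\<in>annulus B m. ennreal (X n l z ^ (s + 2)) \<partial>\<mu>)
            \<le> ennreal (q n l) * ennreal (K * \<tau> ^ ((m - n) + (n - m)) * (W n / real B ^ n))"
          unfolding K_def by (intro mult_left_mono nn_integral_annulus_kern_le l s) simp
        also have "\<dots> = ennreal (q n l * (K * \<tau> ^ ((m - n) + (n - m)) * (W n / real B ^ n)))"
          using q0 by (intro ennreal_mult'[symmetric])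
        also have "\<tau> ^ ((m - n) + (n - m)) = e m n * e m n"
          by (simp add: e_def v(3)[symmetric] power_mult_distrib)
        also have "q n l * (K * (e m n * e m n) * (W n / real B ^ n)) = Q * K * (c (n, l) powr p * e m n)"
          using e[of m n] W_pos[of n] by (simp add: q_def)
        finally show "ennreal (q n l) * (\<integral>\<^sup>+z\<in>annulus B m. ennreal (X n l z ^ (s + 2)) \<partial>\<mu>)
            \<le> ennreal (Q * K * (c (n, l) powr p * e m n))" .
      qed
      also have "\<dots> = ennreal (Q * K * (\<Sum>(n, l)\<in>idx B N. c (n, l) powr p * e m n))"
        using Q K e unfolding sum_distrib_left case_prod_unfold
        by (subst sum_ennreal) (auto intro!: mult_nonneg_nonneg simp: less_imp_le)
      finally show ?thesis .
    qed
    have "(\<integral>\<^sup>+z. S z \<partial>\<mu>) \<le> (\<Sum>m. \<integral>\<^sup>+z\<in>annulus B m. S z \<partial>\<mu>)"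
      by (rule nn_integral_le_suminf_annulus) measurable
    also have "\<dots> \<le> ennreal (M * (\<Sum>j\<in>idx B N. c j powr p))"
    proof (rule suminf_le_const)
      fix T
      have "(\<Sum>m<T. \<integral>\<^sup>+z\<in>annulus B m. S z \<partial>\<mu>) \<le> (\<Sum>m<T. ennreal (Q * K * (\<Sum>(n, l)\<in>idx B N. c (n, l) powr p * e m n)))"
        by (intro sum_mono level)
      also have "\<dots> = ennreal (\<Sum>m<T. Q * K * (\<Sum>(n, l)\<in>idx B N. c (n, l) powr p * e m n))"
        using Q K e by (intro sum_ennreal mult_nonneg_nonneg sum_nonneg) (auto simp: less_imp_le split: prod.split)
      also have "\<dots> \<le> ennreal (M * (\<Sum>j\<in>idx B N. c j powr p))"
      proof (intro ennreal_leI)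
        have "(\<Sum>m<T. Q * K * (\<Sum>(n, l)\<in>idx B N. c (n, l) powr p * e m n))
           = Q * K * (\<Sum>(n, l)\<in>idx B N. c (n, l) powr p * (\<Sum>m<T. e m n))"
          unfolding sum_distrib_left case_prod_unfold by (rule sum.swap)
        also have "\<dots> \<le> Q * K * (\<Sum>(n, l)\<in>idx B N. c (n, l) powr p * (2 / (1 - v)))"
        proof (intro mult_left_mono sum_mono, clarify)
          fix n l
          have "(\<Sum>m<T. e m n) \<le> 2 / (1 - v)"
            using sum_power_dist_le[of v n T] v by (simp add: e_def add.commute)
          then show "c (n, l) powr p * (\<Sum>m<T. e m n) \<le> c (n, l) powr p * (2 / (1 - v))"
            by (intro mult_left_mono) auto
        qed (use Q K in auto)
        also have "\<dots> = M * (\<Sum>j\<in>idx B N. c j powr p)"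
          by (simp add: M_def case_prod_unfold sum_distrib_left sum_distrib_right sum_divide_distrib mult_ac)
        finally show "(\<Sum>m<T. Q * K * (\<Sum>(n, l)\<in>idx B N. c (n, l) powr p * e m n)) \<le> M * (\<Sum>j\<in>idx B N. c j powr p)" .
      qed
      finally show "(\<Sum>m<T. \<integral>\<^sup>+z\<in>annulus B m. S z \<partial>\<mu>) \<le> ennreal (M * (\<Sum>j\<in>idx B N. c j powr p))" .
    qed simp
    finally show "(\<integral>\<^sup>+z. ennreal ((\<Sum>(n, l)\<in>idx B N. c (n, l) * (W n / real B ^ n) powr (- 1 / p) * X n l z ^ k) powr p) \<partial>\<mu>)
        \<le> ennreal (M * (\<Sum>j\<in>idx B N. c j powr p))" by (simp add: S_def)
  qed
qed

end

section \<open>Separating the two operators\<close>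

text \<open>The factor cnj a / (1 - |a|) is free of the exponent k and can be absorbed into V, which
  leaves the form of \<open>separation_of_powers\<close>.\<close>

lemma kern_power_has_field_derivative:
  assumes a: "norm a < 1" and z: "norm z < 1"
  shows "((\<lambda>w. kern a w ^ k) has_field_derivative
           of_nat k * (cnj a / of_real (1 - norm a)) * kern a z ^ (k + 1)) (at z)"
proof -
  have "norm (cnj a * z) < 1" using a z norm_mult_less[of "cnj a" 1 z 1] by simp
  then have nz: "1 - cnj a * z \<noteq> 0" by auto
  have na: "of_real (1 - norm a) \<noteq> (0::complex)" using a by (simp del: of_real_diff)
  have d: "(kern a has_field_derivative of_real (1 - norm a) * cnj a / (1 - cnj a * z)\<^sup>2) (at z)"
    unfolding kern_def using nz by (auto intro!: derivative_eq_intros simp: power2_eq_square)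
  have "of_real (1 - norm a) * cnj a / (1 - cnj a * z)\<^sup>2 = cnj a / of_real (1 - norm a) * (kern a z)\<^sup>2"
    using na by (simp add: kern_def power2_eq_square del: of_real_diff)
  with d have d: "(kern a has_field_derivative cnj a / of_real (1 - norm a) * (kern a z)\<^sup>2) (at z)" by simp
  have 1: "((\<lambda>w. kern a w ^ k) has_field_derivative of_nat k * kern a z ^ (k - 1) * (cnj a / of_real (1 - norm a) * (kern a z)\<^sup>2)) (at z)"
    by (auto intro!: derivative_eq_intros d)
  have 2: "of_nat k * kern a z ^ (k - 1) * (cnj a / of_real (1 - norm a) * (kern a z)\<^sup>2)
      = of_nat k * (cnj a / of_real (1 - norm a)) * kern a z ^ (k + 1)"
    by (cases k) (auto simp: power2_eq_square)
  show ?thesis by (rule DERIV_cong[OF 1 2])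
qed

lemma norm_node_less_1: "2 \<le> B \<Longrightarrow> norm (node B n l) < 1"
  by (simp add: norm_node)

lemma borel_measurable_continuous_on_disc:
  assumes "sets \<upsilon> = sets (restrict_space borel (ball 0 1 :: complex set))" "continuous_on (ball 0 1) f"
  shows "f \<in> borel_measurable \<upsilon>"
  unfolding measurable_cong_sets[OF assms(1) refl]
  by (rule borel_measurable_continuous_on_restrict[OF assms(2)])

lemma space_disc:
  assumes "sets \<upsilon> = sets (restrict_space borel (ball 0 1 :: complex set))"
  shows "space \<upsilon> = ball 0 1"
  using sets_eq_imp_space_eq[OF assms] by (simp add: space_restrict_space)

lemma continuous_on_weighted_composition:
  assumes "u holomorphic_on ball 0 1" "g holomorphic_on ball 0 1" "\<phi> holomorphic_on ball 0 1"
    "\<phi> ` ball 0 1 \<subseteq> ball (0::complex) 1"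
  shows "continuous_on (ball 0 1) (\<lambda>z. u z * g (\<phi> z))"
  by (rule continuous_on_mult[OF holomorphic_on_imp_continuous_on[OF assms(1)]
        continuous_on_compose2[OF holomorphic_on_imp_continuous_on[OF assms(2)]
          holomorphic_on_imp_continuous_on[OF assms(3)] assms(4)]])

context radial_doubling_measure begin

text \<open>On each level the kernel squares sum to at most 4, and the annuli of different levels
  are disjoint. Hence the right-hand sides of the sampling inequality have a sum bounded uniformly
  in N.\<close>

lemma sum_weighted_annulus_le:
  assumes f: "f holomorphic_on ball 0 1"
  shows "(\<Sum>(n, l)\<in>idx B N. \<integral>\<^sup>+w\<in>annulus B (n + 2). ennreal (norm (f w) powr p * (X n l w)\<^sup>2) \<partial>\<mu>)
     \<le> 4 * (\<integral>\<^sup>+w\<in>ball 0 1. ennreal (norm (f w) powr p) \<partial>\<mu>)"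
proof -
  have fm [measurable]: "(\<lambda>w. norm (f w) * indicator (ball 0 1) w) \<in> borel_measurable borel"
    using holomorphic_on_imp_continuous_on[OF f] by (rule borel_measurable_norm_indicator) simp
  define h where "h w = ennreal ((norm (f w) * indicator (ball 0 1) w) powr p) * indicator (ball 0 1) w" for w
  have [measurable]: "ball 0 1 \<in> sets (borel :: complex measure)" by simp
  have [measurable]: "h \<in> borel_measurable borel" unfolding h_def by measurable
  have h: "h w = ennreal (norm (f w) powr p) * indicator (ball 0 1) w" for w
    by (auto simp: h_def indicator_def)
  have hA: "ennreal (norm (f w) powr p * x) * indicator (annulus B n) w = h w * ennreal x * indicator (annulus B n) w"
    if "0 \<le> x" for w x n
    using that by (auto simp: h indicator_def ennreal_mult dest: annulus_norm_less_1)
  have "(\<Sum>(n, l)\<in>idx B N. \<integral>\<^sup>+w\<in>annulus B (n + 2). ennreal (norm (f w) powr p * (X n l w)\<^sup>2) \<partial>\<mu>)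
     = (\<Sum>n<N. \<Sum>l<B ^ n. \<integral>\<^sup>+w. h w * ennreal ((X n l w)\<^sup>2) * indicator (annulus B (n + 2)) w \<partial>\<mu>)"
    by (simp add: sum_idx hA)
  also have "\<dots> = (\<integral>\<^sup>+w. (\<Sum>n<N. \<Sum>l<B ^ n. h w * ennreal ((X n l w)\<^sup>2) * indicator (annulus B (n + 2)) w) \<partial>\<mu>)"
  proof -
    define g where "g n l w = h w * ennreal ((X n l w)\<^sup>2) * indicator (annulus B (n + 2)) w" for n l w
    have [measurable]: "g n l \<in> borel_measurable borel" for n l unfolding g_def by measurable
    have "(\<Sum>n<N. \<Sum>l<B ^ n. \<integral>\<^sup>+w. g n l w \<partial>\<mu>) = (\<integral>\<^sup>+w. (\<Sum>n<N. \<Sum>l<B ^ n. g n l w) \<partial>\<mu>)"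
      by (simp add: nn_integral_sum)
    then show ?thesis unfolding g_def .
  qed
  also have "\<dots> \<le> (\<integral>\<^sup>+w. 4 * h w \<partial>\<mu>)"
  proof (intro nn_integral_mono)
    fix w
    have "(\<Sum>l<B ^ n. h w * ennreal ((X n l w)\<^sup>2) * indicator (annulus B (n + 2)) w)
        \<le> 4 * h w * indicator (annulus B (n + 2)) w" for n
    proof (cases "w \<in> annulus B (n + 2)")
      case True
      have "(\<Sum>l<B ^ n. ennreal ((X n l w)\<^sup>2)) \<le> ennreal 4"
        using sum_norm_kern_node_le[OF B annulus_norm_less_1[OF True], of n] by (simp add: ennreal_leI del: ennreal_numeral)
      then have "h w * (\<Sum>l<B ^ n. ennreal ((X n l w)\<^sup>2)) \<le> h w * 4" by (intro mult_left_mono) auto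
      then show ?thesis using True unfolding sum_distrib_left by (simp add: mult.commute)
    qed simp
    then have "(\<Sum>n<N. \<Sum>l<B ^ n. h w * ennreal ((X n l w)\<^sup>2) * indicator (annulus B (n + 2)) w)
       \<le> (\<Sum>n<N. 4 * h w * indicator (annulus B (n + 2)) w)" by (intro sum_mono)
    also have "\<dots> = 4 * h w * (\<Sum>n<N. indicator (annulus B (n + 2)) w)" by (simp add: sum_distrib_left)
    also have "(\<Sum>n<N. indicator (annulus B (n + 2)) w) = (indicator (\<Union>n<N. annulus B (n + 2)) w :: ennreal)"
      using disjoint_family_annulus by (intro indicator_UN_disjoint[symmetric]) (auto simp: disjoint_family_on_def)
    also have "4 * h w * indicator (\<Union>n<N. annulus B (n + 2)) w \<le> 4 * h w" by (auto simp: indicator_def)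
    finally show "(\<Sum>n<N. \<Sum>l<B ^ n. h w * ennreal ((X n l w)\<^sup>2) * indicator (annulus B (n + 2)) w) \<le> 4 * h w" .
  qed
  also have "\<dots> = 4 * (\<integral>\<^sup>+w. h w \<partial>\<mu>)" by (simp add: nn_integral_cmult)
  finally show ?thesis by (simp add: h)
qed

text \<open>Provides the lower bound on |x| for \<open>separation_of_powers\<close>: the denominator
  is at most (2 + 8) / \<open>B ^ n\<close>.\<close>

lemma kernel_point_ge:
  assumes "\<zeta> \<in> annulus B n" "norm (\<zeta> - node B n l) \<le> 8 / real B ^ n"
  shows "1 / 10 \<le> X n l \<zeta>"
proof -
  define a where "a = node B n l"
  have a: "norm a = 1 - 1 / real B ^ n" "norm a \<le> 1" "norm a < 1"
    using norm_node[OF B] norm_node_le_1[OF B] norm_node_less_1[OF B] by (auto simp: a_def)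
  have z: "norm \<zeta> \<le> 1" using annulus_norm_less_1[OF assms(1)] by simp
  have "norm (1 - cnj a * \<zeta>) \<le> 10 / real B ^ n"
    using norm_one_minus_cnj_le[OF a(2), of \<zeta>] assms(2) a by (simp add: a_def)
  moreover have "0 < norm (1 - cnj a * \<zeta>)"
    using norm_one_minus_cnj_mult_ge(1)[OF a(2) z] a(3) by linarith
  moreover have "X n l \<zeta> = (1 / real B ^ n) / norm (1 - cnj a * \<zeta>)"
    using norm_kern[OF a(2), of \<zeta>] a(1) by (simp add: a_def)
  ultimately show ?thesis by (simp add: pos_le_divide_eq mult.commute)
qed

text \<open>In terms of q-th powers, A bounds T on the unit ball. The node used to estimate the
  integrand varies with z, but the sign average of the fixed functions G contains its term, so the
  estimate integrates against \<upsilon>.\<close>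

theorem weighted_composition_le_sum_operator:
  assumes p: "1 < p" and q: "1 < q"
  shows "\<exists>C>0. \<forall>(\<upsilon> :: complex measure) \<phi> \<psi> u0 u1 f A.
      sets \<upsilon> = sets (restrict_space borel (ball 0 1)) \<longrightarrow>
      \<phi> holomorphic_on ball 0 1 \<longrightarrow> \<phi> ` ball 0 1 \<subseteq> ball 0 1 \<longrightarrow>
      \<psi> holomorphic_on ball 0 1 \<longrightarrow> \<psi> ` ball 0 1 \<subseteq> ball 0 1 \<longrightarrow>
      u0 holomorphic_on ball 0 1 \<longrightarrow> u1 holomorphic_on ball 0 1 \<longrightarrow>
      f holomorphic_on ball 0 1 \<longrightarrow> (\<integral>\<^sup>+z\<in>ball 0 1. ennreal (norm (f z) powr p) \<partial>\<mu>) \<le> 1 \<longrightarrow>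
      (\<forall>g. g holomorphic_on ball 0 1 \<longrightarrow> (\<integral>\<^sup>+z\<in>ball 0 1. ennreal (norm (g z) powr p) \<partial>\<mu>) \<le> 1 \<longrightarrow>
         (\<integral>\<^sup>+z. ennreal (norm (u0 z * g (\<phi> z) + u1 z * deriv g (\<psi> z)) powr q) \<partial>\<upsilon>) \<le> A) \<longrightarrow>
      (\<integral>\<^sup>+z. ennreal (norm (u0 z * f (\<phi> z)) powr q) \<partial>\<upsilon>) \<le> ennreal C * A"
proof -
  obtain s where s: "2 * D < real B ^ s" using real_arch_pow[of "real B" "2 * D"] B by auto
  \<comment> \<open>The least exponent allowed by \<open>kernel_sum_powr_le\<close>; m + 1 and m + 2
    are then allowed as well.\<close>
  define m where "m = s + 4"
  obtain M where M: "0 < M"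
    "\<forall>N k (c :: nat \<times> nat \<Rightarrow> real). s + 4 \<le> k \<longrightarrow> (\<forall>j\<in>idx B N. 0 \<le> c j) \<longrightarrow>
       (\<integral>\<^sup>+z. ennreal ((\<Sum>(n, l)\<in>idx B N. c (n, l) * (W n / real B ^ n) powr (- 1 / p) * X n l z ^ k) powr p) \<partial>\<mu>)
        \<le> ennreal (M * (\<Sum>j\<in>idx B N. c j powr p))"
    using kernel_sum_powr_le[OF p less_imp_le[OF s]] by blast
  obtain C1 where C1: "0 < C1"
    "\<forall>f \<zeta> n l. f holomorphic_on ball 0 1 \<longrightarrow> \<zeta> \<in> annulus B n \<longrightarrow> l < B ^ n \<longrightarrow>
       norm (\<zeta> - node B n l) \<le> 8 / real B ^ n \<longrightarrow>
       ennreal (norm (f \<zeta>) powr p * (W n / real B ^ n))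
         \<le> ennreal C1 * (\<integral>\<^sup>+w\<in>annulus B (n + 2). ennreal (norm (f w) powr p * (X n l w)\<^sup>2) \<partial>\<mu>)"
    using sampling_inequality[OF p] by blast
  obtain C2 where C2: "0 < C2"
    "\<forall>x y U V :: complex. 1 / 10 \<le> norm x \<longrightarrow> norm x \<le> 1 \<longrightarrow> norm y \<le> 1 \<longrightarrow>
       norm U \<le> C2 * (\<Sum>k<3. norm (U * x ^ (m + k) + of_nat (m + k) * V * y ^ (m + k + 1)))"
    using separation_of_powers[of "1 / 10" m] by auto
  \<comment> \<open>The sum of the \<open>c j powr p\<close> is at most 4, so division by L brings
    the test functions into the unit ball.\<close>
  define L where "L = (4 * M) powr (1 / p)"
  have L: "0 < L" "L powr p = 4 * M" using M(1) p by (auto simp: L_def powr_powr)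
  \<comment> \<open>The constants of sampling and of separation, and 3 powr (q - 1) from the power
    mean over the three exponents. In C, the 3 counts the exponents and L powr q undoes the
    normalisation.\<close>
  define H where "H = (C1 powr (1 / p) * C2) powr q * 3 powr (q - 1)"
  have H: "0 < H" using C1(1) C2(1) by (simp add: H_def)
  define C where "C = H * 3 * L powr q"
  have C: "0 < C" using H L by (simp add: C_def)
  show ?thesis
  proof (intro exI[of _ C] conjI allI impI C)
    fix \<upsilon> :: "complex measure" and \<phi> \<psi> u0 u1 f and A :: ennreal
    assume \<upsilon>: "sets \<upsilon> = sets (restrict_space borel (ball 0 1))"
      and \<phi>: "\<phi> holomorphic_on ball 0 1" "\<phi> ` ball 0 1 \<subseteq> ball 0 1"
      and \<psi>: "\<psi> holomorphic_on ball 0 1" "\<psi> ` ball 0 1 \<subseteq> ball 0 1"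
      and u0: "u0 holomorphic_on ball 0 1" and u1: "u1 holomorphic_on ball 0 1"
      and f: "f holomorphic_on ball 0 1" and f1: "(\<integral>\<^sup>+z\<in>ball 0 1. ennreal (norm (f z) powr p) \<partial>\<mu>) \<le> 1"
      and A: "\<forall>g. g holomorphic_on ball 0 1 \<longrightarrow> (\<integral>\<^sup>+z\<in>ball 0 1. ennreal (norm (g z) powr p) \<partial>\<mu>) \<le> 1 \<longrightarrow>
         (\<integral>\<^sup>+z. ennreal (norm (u0 z * g (\<phi> z) + u1 z * deriv g (\<psi> z)) powr q) \<partial>\<upsilon>) \<le> A"
    have sp: "space \<upsilon> = ball 0 1" using space_disc[OF \<upsilon>] .
    \<comment> \<open>\<open>dd j\<close> is the integral in the sampling inequality at the node j
      and \<open>c j\<close> its p-th root. The conversion by \<open>enn2real\<close> is exact on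
      the index set, since each \<open>dd j\<close> is at most the total 4.\<close>
    define dd where "dd = (\<lambda>(n, l). \<integral>\<^sup>+w\<in>annulus B (n + 2). ennreal (norm (f w) powr p * (X n l w)\<^sup>2) \<partial>\<mu>)"
    define c where "c j = enn2real (dd j) powr (1 / p)" for j
    have dsum: "(\<Sum>j\<in>idx B N. dd j) \<le> 4" for N
    proof -
      have "(\<Sum>j\<in>idx B N. dd j) \<le> 4 * (\<integral>\<^sup>+z\<in>ball 0 1. ennreal (norm (f z) powr p) \<partial>\<mu>)"
        unfolding dd_def by (rule sum_weighted_annulus_le[OF f])
      also have "\<dots> \<le> 4 * 1" by (intro mult_left_mono f1) auto
      finally show ?thesis by simp
    qed
    have dfin: "dd j = ennreal (c j powr p)" if "j \<in> idx B N" for j N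
    proof -
      have "dd j \<le> (\<Sum>j\<in>idx B N. dd j)" using that by (intro member_le_sum) auto
      also have "\<dots> \<le> 4" by (rule dsum)
      finally have "dd j < top" by (auto intro: le_less_trans)
      then show ?thesis using p by (simp add: c_def powr_powr)
    qed
    have csum: "(\<Sum>j\<in>idx B N. c j powr p) \<le> 4" for N
    proof -
      have "ennreal (\<Sum>j\<in>idx B N. c j powr p) = (\<Sum>j\<in>idx B N. dd j)"
        using dfin by (simp flip: sum_ennreal)
      then have "ennreal (\<Sum>j\<in>idx B N. c j powr p) \<le> ennreal 4" using dsum[of N] by simp
      then show ?thesis by (subst (asm) ennreal_le_iff) auto
    qed
    have c0: "0 \<le> c j" for j by (simp add: c_def)
    define e where "e = (\<lambda>(n, l). c (n, l) * (W n / real B ^ n) powr (- 1 / p))"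
    have e0: "0 \<le> e j" for j using c0 by (auto simp: e_def split: prod.split)
    define a where "a = (\<lambda>(n, l). node B n l)"
    have a1: "norm (a j) < 1" for j using norm_node_less_1[OF B] by (auto simp: a_def split: prod.split)
    define V where "V j z = u1 z * (cnj (a j) / of_real (1 - norm (a j)))" for j z
    \<comment> \<open>This is T applied to \<open>kern (a j) ^ (m + k)\<close>, with U =
      \<open>u0 z\<close> and with x, y the kernel at \<phi> z and \<psi> z.\<close>
    define t where "t k j z = u0 z * kern (a j) (\<phi> z) ^ (m + k) + of_nat (m + k) * V j z * kern (a j) (\<psi> z) ^ (m + k + 1)" for k j z
    define sg where "sg S j = (if j \<in> S then 1 else - 1 :: complex)" for S and j :: "nat \<times> nat"
    define G where "G N S k \<zeta> = (\<Sum>j\<in>idx B N. sg S j * of_real (e j) * kern (a j) \<zeta> ^ (m + k))" for N S k \<zeta>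
    have Gd: "(G N S k has_field_derivative
        (\<Sum>j\<in>idx B N. sg S j * of_real (e j) * (of_nat (m + k) * (cnj (a j) / of_real (1 - norm (a j))) * kern (a j) \<zeta> ^ (m + k + 1)))) (at \<zeta>)"
      if "norm \<zeta> < 1" for N S k \<zeta>
      unfolding G_def
      by (intro DERIV_sum DERIV_cmult kern_power_has_field_derivative a1 that)
    have Gh: "G N S k holomorphic_on ball 0 1" for N S k
      unfolding holomorphic_on_open[OF open_ball]
    proof
      fix \<zeta> :: complex assume "\<zeta> \<in> ball 0 1"
      then have "norm \<zeta> < 1" by simp
      then show "\<exists>f'. (G N S k has_field_derivative f') (at \<zeta>)" by (intro exI) (rule Gd)
    qed
    have TG: "u0 z * G N S k (\<phi> z) + u1 z * deriv (G N S k) (\<psi> z) = (\<Sum>j\<in>idx B N. sg S j * (of_real (e j) * t k j z))"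
      if "z \<in> ball 0 1" for N S k z
    proof -
      have "norm (\<psi> z) < 1" using that \<psi>(2) by force
      note D = DERIV_imp_deriv[OF Gd[OF this]]
      show ?thesis
        unfolding D unfolding G_def sum_distrib_left unfolding sum.distrib[symmetric]
        by (intro sum.cong refl) (simp add: t_def V_def distrib_left mult_ac)
    qed
    have Gnorm: "(\<integral>\<^sup>+z\<in>ball 0 1. ennreal (norm (G N S k z / of_real L) powr p) \<partial>\<mu>) \<le> 1" for N S k
    proof -
      have "(\<integral>\<^sup>+z\<in>ball 0 1. ennreal (norm (G N S k z / of_real L) powr p) \<partial>\<mu>)
         \<le> (\<integral>\<^sup>+z. ennreal (1 / (4 * M)) * ennreal ((\<Sum>(n, l)\<in>idx B N. c (n, l) * (W n / real B ^ n) powr (- 1 / p) * X n l z ^ (m + k)) powr p) \<partial>\<mu>)"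
      proof (intro nn_integral_mono)
        fix z
        define Y where "Y = (\<Sum>(n, l)\<in>idx B N. c (n, l) * (W n / real B ^ n) powr (- 1 / p) * X n l z ^ (m + k))"
        have "norm (G N S k z) \<le> (\<Sum>j\<in>idx B N. norm (sg S j * of_real (e j) * kern (a j) z ^ (m + k)))"
          unfolding G_def by (rule norm_sum)
        also have "\<dots> = Y"
          unfolding Y_def using e0 by (intro sum.cong) (auto simp: norm_mult norm_power sg_def e_def a_def c0)
        finally have "norm (G N S k z / of_real L) \<le> Y / L" using L by (simp add: norm_divide divide_right_mono)
        then have "norm (G N S k z / of_real L) powr p \<le> (Y / L) powr p" using p by (intro powr_mono2) auto
        also have "\<dots> = 1 / (4 * M) * Y powr p"
        proof -
          have "0 \<le> Y" unfolding Y_def using c0 by (intro sum_nonneg) (auto split: prod.split)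
          then show ?thesis using L by (simp add: powr_divide)
        qed
        finally have "ennreal (norm (G N S k z / of_real L) powr p) \<le> ennreal (1 / (4 * M) * Y powr p)" by (rule ennreal_leI)
        also have "\<dots> = ennreal (1 / (4 * M)) * ennreal (Y powr p)" using M(1) by (intro ennreal_mult) auto
        finally show "ennreal (norm (G N S k z / of_real L) powr p) * indicator (ball 0 1) z \<le> ennreal (1 / (4 * M)) * ennreal (Y powr p)"
          by (auto simp: indicator_def)
      qed
      also have "\<dots> = ennreal (1 / (4 * M)) * (\<integral>\<^sup>+z. ennreal ((\<Sum>(n, l)\<in>idx B N. c (n, l) * (W n / real B ^ n) powr (- 1 / p) * X n l z ^ (m + k)) powr p) \<partial>\<mu>)"
        unfolding case_prod_unfold by (rule nn_integral_cmult) measurable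
      also have "\<dots> \<le> ennreal (1 / (4 * M)) * ennreal (M * (\<Sum>j\<in>idx B N. c j powr p))"
        using c0 by (intro mult_left_mono M(2)[rule_format]) (auto simp: m_def)
      also have "\<dots> \<le> ennreal (1 / (4 * M)) * ennreal (M * 4)"
        using csum M(1) by (intro mult_left_mono ennreal_leI) auto
      also have "\<dots> = 1" using M(1) by (simp flip: ennreal_mult)
      finally show ?thesis .
    qed
    \<comment> \<open>On the disc this is the modulus of T applied to \<open>G N S k\<close>,
      written as a signed sum so that the average over S can be compared with one term.\<close>
    define F where "F N S k z = norm (\<Sum>j\<in>idx B N. if j \<in> S then of_real (e j) * t k j z else - (of_real (e j) * t k j z))" for N S k z
    have F: "F N S k z = norm (u0 z * G N S k (\<phi> z) + u1 z * deriv (G N S k) (\<psi> z))" if "z \<in> ball 0 1" for N S k z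
      unfolding F_def TG[OF that] by (intro arg_cong[of _ _ norm] sum.cong) (auto simp: sg_def)
    have Fm: "(\<lambda>z. ennreal (F N S k z powr q)) \<in> borel_measurable \<upsilon>" for N S k
    proof -
      have "continuous_on (ball 0 1) (\<lambda>z. u0 z * G N S k (\<phi> z) + u1 z * deriv (G N S k) (\<psi> z))"
        by (intro continuous_on_add continuous_on_weighted_composition u0 u1 \<phi> \<psi> Gh holomorphic_deriv) auto
      from borel_measurable_continuous_on_disc[OF \<upsilon> this]
      have "(\<lambda>z. ennreal (norm (u0 z * G N S k (\<phi> z) + u1 z * deriv (G N S k) (\<psi> z)) powr q)) \<in> borel_measurable \<upsilon>"
        by measurable
      then show ?thesis by (rule measurable_cong[THEN iffD1, rotated]) (simp add: F sp)
    qed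
    have FA: "(\<integral>\<^sup>+z. ennreal (F N S k z powr q) \<partial>\<upsilon>) \<le> ennreal (L powr q) * A" for N S k
    proof -
      have gh: "(\<lambda>z. G N S k z / of_real L) holomorphic_on ball 0 1" using L by (intro holomorphic_intros Gh) auto
      have "(\<integral>\<^sup>+z. ennreal (F N S k z powr q) \<partial>\<upsilon>)
         = (\<integral>\<^sup>+z. ennreal (L powr q) * ennreal (norm (u0 z * (G N S k (\<phi> z) / of_real L) + u1 z * deriv (\<lambda>z. G N S k z / of_real L) (\<psi> z)) powr q) \<partial>\<upsilon>)"
      proof (intro nn_integral_cong)
        fix z assume "z \<in> space \<upsilon>"
        then have z: "z \<in> ball 0 1" by (simp add: sp)
        then have "norm (\<psi> z) < 1" using \<psi>(2) by force
        then have "deriv (\<lambda>z. G N S k z / of_real L) (\<psi> z) = deriv (G N S k) (\<psi> z) / of_real L"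
          using Gd[THEN DERIV_cdivide, of "\<psi> z" N S k "of_real L"] Gd[of "\<psi> z" N S k] by (simp add: DERIV_imp_deriv)
        then have "u0 z * (G N S k (\<phi> z) / of_real L) + u1 z * deriv (\<lambda>z. G N S k z / of_real L) (\<psi> z)
          = (u0 z * G N S k (\<phi> z) + u1 z * deriv (G N S k) (\<psi> z)) / of_real L" by (simp add: add_divide_distrib)
        then have "norm (u0 z * (G N S k (\<phi> z) / of_real L) + u1 z * deriv (\<lambda>z. G N S k z / of_real L) (\<psi> z)) = F N S k z / L"
          using L by (simp add: F[OF z] norm_divide)
        then show "ennreal (F N S k z powr q) = ennreal (L powr q) * ennreal (norm (u0 z * (G N S k (\<phi> z) / of_real L) + u1 z * deriv (\<lambda>z. G N S k z / of_real L) (\<psi> z)) powr q)"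
          using L by (simp add: powr_divide F_def flip: ennreal_mult)
      qed
      also have "\<dots> = ennreal (L powr q) * (\<integral>\<^sup>+z. ennreal (norm (u0 z * (G N S k (\<phi> z) / of_real L) + u1 z * deriv (\<lambda>z. G N S k z / of_real L) (\<psi> z)) powr q) \<partial>\<upsilon>)"
      proof (rule nn_integral_cmult)
        have "continuous_on (ball 0 1) (\<lambda>z. u0 z * (G N S k (\<phi> z) / of_real L) + u1 z * deriv (\<lambda>z. G N S k z / of_real L) (\<psi> z))"
          using gh by (intro continuous_on_add continuous_on_weighted_composition[OF u0 gh] continuous_on_weighted_composition u1 \<phi> \<psi> holomorphic_deriv) auto
        from borel_measurable_continuous_on_disc[OF \<upsilon> this]
        show "(\<lambda>z. ennreal (norm (u0 z * (G N S k (\<phi> z) / of_real L) + u1 z * deriv (\<lambda>z. G N S k z / of_real L) (\<psi> z)) powr q)) \<in> borel_measurable \<upsilon>"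
          by measurable
      qed
      also have "\<dots> \<le> ennreal (L powr q) * A"
        by (intro mult_left_mono A[rule_format] gh Gnorm) auto
      finally show ?thesis .
    qed
    have pw: "norm (u0 z * f (\<phi> z)) powr q \<le> H * (\<Sum>k<3. (\<Sum>S\<in>Pow (idx B N). F N S k z powr q) / 2 ^ card (idx B N))"
      if z: "z \<in> ball 0 1" "norm (\<phi> z) < 1 - 1 / real B ^ N" for z N
    proof -
      have \<phi>1: "norm (\<phi> z) < 1" and \<psi>1: "norm (\<psi> z) < 1" using z \<phi> \<psi> by force+
      obtain n where n: "\<phi> z \<in> annulus B n" using exists_annulus[OF B \<phi>1] .
      have lt: "1 - 1 / real B ^ n < 1 - 1 / real B ^ N" using n z(2) unfolding annulus_def by auto
      have nN: "n < N"
      proof (rule ccontr)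
        assume "\<not> n < N"
        then have "1 / real B ^ n \<le> 1 / real B ^ N" using B by (intro divide_left_mono power_increasing) auto
        then show False using lt by linarith
      qed
      obtain l where l: "l < B ^ n" "norm (\<phi> z - node B n l) \<le> 8 / real B ^ n"
        using exists_node_near[OF B n] .
      define j where "j = (n, l)"
      have j: "j \<in> idx B N" using nN l by (simp add: j_def idx_def)
      define w where "w = W n / real B ^ n"
      have w: "0 < w" using W_pos[of n] by (simp add: w_def)
      have "ennreal (norm (f (\<phi> z)) powr p * w) \<le> ennreal C1 * dd j"
        using C1(2)[rule_format, OF f n l] by (simp add: dd_def j_def w_def)
      also have "\<dots> = ennreal (C1 * c j powr p)" using dfin[OF j] C1(1) by (simp add: ennreal_mult)
      finally have "norm (f (\<phi> z)) powr p * w \<le> C1 * c j powr p" using C1(1) by (subst (asm) ennreal_le_iff) auto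
      then have "norm (f (\<phi> z)) powr p \<le> C1 * c j powr p / w" using w by (simp add: pos_le_divide_eq)
      then have "(norm (f (\<phi> z)) powr p) powr (1 / p) \<le> (C1 * c j powr p / w) powr (1 / p)"
        using p by (intro powr_mono2) auto
      then have "norm (f (\<phi> z)) \<le> C1 powr (1 / p) * c j / w powr (1 / p)"
        using p C1(1) w c0[of j] by (simp add: powr_powr powr_mult powr_divide)
      also have "\<dots> = C1 powr (1 / p) * e j"
        using powr_minus_divide[of w "1 / p"] by (simp add: e_def j_def w_def)
      finally have ff: "norm (f (\<phi> z)) \<le> C1 powr (1 / p) * e j" .
      \<comment> \<open>The node was chosen near \<phi> z, so the kernel there is at least 1/10 in
        modulus; at \<psi> z only the bound 1 enters.\<close>
      have "norm (u0 z) \<le> C2 * (\<Sum>k<3. norm (t k j z))"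
        unfolding t_def using kernel_point_ge[OF n l(2)] norm_kern_le_1[of "a j"] a1[of j] \<phi>1 \<psi>1
        by (intro C2(2)[rule_format]) (auto simp: a_def j_def)
      then have "norm (u0 z * f (\<phi> z)) \<le> C2 * (\<Sum>k<3. norm (t k j z)) * (C1 powr (1 / p) * e j)"
        unfolding norm_mult using ff by (intro mult_mono) (auto intro: order_trans[OF norm_ge_zero])
      also have "\<dots> = C1 powr (1 / p) * C2 * (\<Sum>k<3. norm (of_real (e j) * t k j z) * 1)"
        using e0[of j] by (simp add: norm_mult sum_distrib_left mult_ac)
      finally have "norm (u0 z * f (\<phi> z)) powr q \<le> (C1 powr (1 / p) * C2 * (\<Sum>k<3. norm (of_real (e j) * t k j z) * 1)) powr q"
        using q by (intro powr_mono2) auto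
      also have "\<dots> = (C1 powr (1 / p) * C2) powr q * (\<Sum>k<3. norm (of_real (e j) * t k j z) * 1) powr q"
        using C2(1) by (simp add: powr_mult sum_nonneg)
      also have "\<dots> \<le> (C1 powr (1 / p) * C2) powr q * ((\<Sum>k<(3::nat). 1) powr (q - 1) * (\<Sum>k<3. norm (of_real (e j) * t k j z) powr q * 1))"
        using q by (intro mult_left_mono weighted_sum_powr_le) auto
      also have "\<dots> = H * (\<Sum>k<3. norm (of_real (e j) * t k j z) powr q)" by (simp add: H_def)
      also have "\<dots> \<le> H * (\<Sum>k<3. (\<Sum>S\<in>Pow (idx B N). F N S k z powr q) / 2 ^ card (idx B N))"
      proof (intro mult_left_mono sum_mono)
        fix k
        have "2 ^ card (idx B N) * norm (of_real (e j) * t k j z) powr q \<le> (\<Sum>S\<in>Pow (idx B N). F N S k z powr q)"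
          unfolding F_def using q j by (intro powr_norm_le_sum_signs[where v = "\<lambda>j. of_real (e j) * t k j z"]) auto
        then show "norm (of_real (e j) * t k j z) powr q \<le> (\<Sum>S\<in>Pow (idx B N). F N S k z powr q) / 2 ^ card (idx B N)"
          by (simp add: pos_le_divide_eq mult.commute)
      qed (use H in auto)
      finally show ?thesis .
    qed
    \<comment> \<open>On \<open>E N\<close> the point \<phi> z lies in a level below N, so that its
      node belongs to the finite index set.\<close>
    define E where "E N = {z \<in> space \<upsilon>. norm (\<phi> z) < 1 - 1 / real B ^ N}" for N
    have \<phi>m [measurable]: "\<phi> \<in> borel_measurable \<upsilon>"
      by (rule borel_measurable_continuous_on_disc[OF \<upsilon> holomorphic_on_imp_continuous_on[OF \<phi>(1)]])
    have Em [measurable]: "E N \<in> sets \<upsilon>" for N unfolding E_def by measurable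
    have um [measurable]: "(\<lambda>z. u0 z * f (\<phi> z)) \<in> borel_measurable \<upsilon>"
      by (rule borel_measurable_continuous_on_disc[OF \<upsilon> continuous_on_weighted_composition[OF u0 f \<phi>]])
    have bound: "(\<integral>\<^sup>+z\<in>E N. ennreal (norm (u0 z * f (\<phi> z)) powr q) \<partial>\<upsilon>) \<le> ennreal C * A" for N
    proof -
      define n where "n = card (idx B N)"
      have "(\<integral>\<^sup>+z\<in>E N. ennreal (norm (u0 z * f (\<phi> z)) powr q) \<partial>\<upsilon>)
         \<le> (\<integral>\<^sup>+z. (\<Sum>k<3. \<Sum>S\<in>Pow (idx B N). ennreal (H / 2 ^ n) * ennreal (F N S k z powr q)) \<partial>\<upsilon>)"
      proof (intro nn_integral_mono)
        fix z assume "z \<in> space \<upsilon>"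
        then have z: "z \<in> ball 0 1" by (simp add: sp)
        show "ennreal (norm (u0 z * f (\<phi> z)) powr q) * indicator (E N) z
           \<le> (\<Sum>k<3. \<Sum>S\<in>Pow (idx B N). ennreal (H / 2 ^ n) * ennreal (F N S k z powr q))"
        proof (cases "z \<in> E N")
          case True
          have "ennreal (norm (u0 z * f (\<phi> z)) powr q) \<le> ennreal (H * (\<Sum>k<3. (\<Sum>S\<in>Pow (idx B N). F N S k z powr q) / 2 ^ n))"
            using pw[OF z, of N] True unfolding n_def E_def by (intro ennreal_leI) auto
          also have "\<dots> = ennreal (\<Sum>k<3. \<Sum>S\<in>Pow (idx B N). H / 2 ^ n * F N S k z powr q)"
            by (simp add: sum_distrib_left sum_divide_distrib)
          also have "\<dots> = (\<Sum>k<3. \<Sum>S\<in>Pow (idx B N). ennreal (H / 2 ^ n) * ennreal (F N S k z powr q))"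
            using H by (simp add: sum_nonneg flip: ennreal_mult)
          finally show ?thesis using True by simp
        qed simp
      qed
      also have "\<dots> = (\<Sum>k<3. \<Sum>S\<in>Pow (idx B N). ennreal (H / 2 ^ n) * (\<integral>\<^sup>+z. ennreal (F N S k z powr q) \<partial>\<upsilon>))"
      proof -
        have g: "(\<lambda>z. ennreal (H / 2 ^ n) * ennreal (F N S k z powr q)) \<in> borel_measurable \<upsilon>" for S k
          using Fm by measurable
        show ?thesis
          by (subst nn_integral_sum, intro borel_measurable_sum g, intro sum.cong refl,
              subst nn_integral_sum, intro g, intro sum.cong refl nn_integral_cmult Fm)
      qed
      also have "\<dots> \<le> (\<Sum>k<(3::nat). \<Sum>S\<in>Pow (idx B N). ennreal (H / 2 ^ n) * (ennreal (L powr q) * A))"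
        by (intro sum_mono mult_left_mono FA) auto
      \<comment> \<open>The number \<open>2 ^ n\<close> of sign choices cancels the averaging
        factor, which makes the bound independent of N.\<close>
      also have "\<dots> = ennreal 3 * (ennreal (2 ^ n) * (ennreal (H / 2 ^ n) * (ennreal (L powr q) * A)))"
        by (simp add: card_Pow n_def ennreal_of_nat_eq_real_of_nat flip: ennreal_numeral)
      also have "\<dots> = ennreal (3 * (2 ^ n * (H / 2 ^ n * L powr q))) * A"
      proof -
        have nn: "0 \<le> (3::real)" "0 \<le> (2::real) ^ n" "0 \<le> H / 2 ^ n" "0 \<le> L powr q"
          "0 \<le> H / 2 ^ n * L powr q" "0 \<le> 2 ^ n * (H / 2 ^ n * L powr q)" using H by auto
        show ?thesis
          unfolding ennreal_mult[OF nn(1,6)] ennreal_mult[OF nn(2,5)] ennreal_mult[OF nn(3,4)]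
          by (simp only: mult.assoc)
      qed
      also have "3 * (2 ^ n * (H / 2 ^ n * L powr q)) = C" by (simp add: C_def)
      finally show ?thesis .
    qed
    have "(\<integral>\<^sup>+z. ennreal (norm (u0 z * f (\<phi> z)) powr q) \<partial>\<upsilon>) = (\<integral>\<^sup>+z. (SUP N. ennreal (norm (u0 z * f (\<phi> z)) powr q) * indicator (E N) z) \<partial>\<upsilon>)"
    proof (intro nn_integral_cong)
      fix z assume z: "z \<in> space \<upsilon>"
      then have "norm (\<phi> z) < 1" using \<phi>(2) by (force simp: sp)
      from exists_annulus[OF B this] obtain n where "\<phi> z \<in> annulus B n" .
      then have "z \<in> E (Suc n)" using z by (simp add: E_def annulus_def)
      then have "ennreal (norm (u0 z * f (\<phi> z)) powr q) \<le> (SUP N. ennreal (norm (u0 z * f (\<phi> z)) powr q) * indicator (E N) z)"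
        by (intro SUP_upper2[of "Suc n"]) auto
      moreover have "(SUP N. ennreal (norm (u0 z * f (\<phi> z)) powr q) * indicator (E N) z) \<le> ennreal (norm (u0 z * f (\<phi> z)) powr q)"
        by (intro SUP_least) (auto simp: indicator_def)
      ultimately show "ennreal (norm (u0 z * f (\<phi> z)) powr q) = (SUP N. ennreal (norm (u0 z * f (\<phi> z)) powr q) * indicator (E N) z)"
        by (rule antisym)
    qed
    also have "\<dots> = (SUP N. \<integral>\<^sup>+z\<in>E N. ennreal (norm (u0 z * f (\<phi> z)) powr q) \<partial>\<upsilon>)"
    proof (rule nn_integral_monotone_convergence_SUP)
      have "E N \<subseteq> E N'" if "N \<le> N'" for N N'
      proof -
        have "1 / real B ^ N' \<le> 1 / real B ^ N" using that B by (intro divide_left_mono power_increasing) auto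
        then show ?thesis by (auto simp: E_def)
      qed
      then show "incseq (\<lambda>N z. ennreal (norm (u0 z * f (\<phi> z)) powr q) * indicator (E N) z)"
        by (intro monoI le_funI mult_left_mono) (auto simp: indicator_def)
    qed measurable
    also have "\<dots> \<le> ennreal C * A" by (intro SUP_least bound)
    finally show "(\<integral>\<^sup>+z. ennreal (norm (u0 z * f (\<phi> z)) powr q) \<partial>\<upsilon>) \<le> ennreal C * A" .
  qed
qed

end

section \<open>Radial weights and operator norms\<close>

lemma enn_root_le_iff:
  assumes "0 < q" "0 \<le> r"
  shows "enn_root q x \<le> ennreal r \<longleftrightarrow> x \<le> ennreal (r powr q)"
proof (cases x)
  case (real y)
  have "y powr (1 / q) \<le> r \<longleftrightarrow> y \<le> r powr q"
  proof
    assume "y powr (1 / q) \<le> r"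
    then have "(y powr (1 / q)) powr q \<le> r powr q" using assms by (intro powr_mono2) auto
    then show "y \<le> r powr q" using assms real by (simp add: powr_powr)
  next
    assume "y \<le> r powr q"
    then have "y powr (1 / q) \<le> (r powr q) powr (1 / q)" using assms real by (intro powr_mono2) auto
    then show "y powr (1 / q) \<le> r" using assms by (simp add: powr_powr)
  qed
  then show ?thesis using real assms by (simp add: enn_root_def ennreal_le_iff)
qed (simp add: enn_root_def top_unique)

lemma op_norm_le_iff:
  assumes "0 < q" "0 \<le> r"
  shows "op_norm p \<omega> q \<upsilon> T \<le> ennreal r \<longleftrightarrow>
    (\<forall>f. f holomorphic_on unit_disc \<and> Apw_norm p \<omega> f \<le> 1 \<longrightarrow> (\<integral>\<^sup>+z. ennreal (norm (T f z) powr q) \<partial>\<upsilon>) \<le> ennreal (r powr q))"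
  unfolding op_norm_def SUP_le_iff Lq_norm_def enn_root_le_iff[OF assms] by blast

text \<open>Convexity of the power gives the factor 2. The hypothesis is pointwise domination, so
  the lemma serves both for T by its two summands and for one summand by T and the other.\<close>

lemma op_norm_triangle:
  assumes q: "1 < q"
    and m0: "\<And>f. f holomorphic_on unit_disc \<Longrightarrow> T0 f \<in> borel_measurable \<upsilon>"
    and m1: "\<And>f. f holomorphic_on unit_disc \<Longrightarrow> T1 f \<in> borel_measurable \<upsilon>"
    and le: "\<And>f z. norm (T f z) \<le> norm (T0 f z) + norm (T1 f z)"
  shows "op_norm p \<omega> q \<upsilon> T \<le> ennreal 2 * (op_norm p \<omega> q \<upsilon> T0 + op_norm p \<omega> q \<upsilon> T1)"
proof (cases "op_norm p \<omega> q \<upsilon> T0 + op_norm p \<omega> q \<upsilon> T1 = \<infinity>")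
  case True
  show ?thesis unfolding True by (simp add: ennreal_mult_top)
next
  case False
  then obtain r0 r1 where r: "0 \<le> r0" "0 \<le> r1" "op_norm p \<omega> q \<upsilon> T0 = ennreal r0" "op_norm p \<omega> q \<upsilon> T1 = ennreal r1"
    by (cases "op_norm p \<omega> q \<upsilon> T0"; cases "op_norm p \<omega> q \<upsilon> T1") auto
  have q0: "0 < q" and rr: "0 \<le> 2 * (r0 + r1)" using q r by auto
  have "op_norm p \<omega> q \<upsilon> T \<le> ennreal (2 * (r0 + r1))"
    unfolding op_norm_le_iff[OF q0 rr]
  proof (intro allI impI, elim conjE)
    fix f assume f: "f holomorphic_on unit_disc" "Apw_norm p \<omega> f \<le> 1"
    note [measurable] = m0[OF f(1)] m1[OF f(1)]
    have I0: "(\<integral>\<^sup>+z. ennreal (norm (T0 f z) powr q) \<partial>\<upsilon>) \<le> ennreal (r0 powr q)"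
      using r(3) op_norm_le_iff[of q r0 p \<omega> \<upsilon> T0] r q f by auto
    have I1: "(\<integral>\<^sup>+z. ennreal (norm (T1 f z) powr q) \<partial>\<upsilon>) \<le> ennreal (r1 powr q)"
      using r(4) op_norm_le_iff[of q r1 p \<omega> \<upsilon> T1] r q f by auto
    have pw: "norm (T f z) powr q \<le> 2 powr (q - 1) * (norm (T0 f z) powr q + norm (T1 f z) powr q)" for z
    proof -
      have "norm (T f z) powr q \<le> (norm (T0 f z) + norm (T1 f z)) powr q"
        using le q by (intro powr_mono2) auto
      also have "\<dots> \<le> 2 powr (q - 1) * (norm (T0 f z) powr q + norm (T1 f z) powr q)"
        using weighted_sum_powr_le[of "{True, False}" q "\<lambda>i. if i then norm (T0 f z) else norm (T1 f z)" "\<lambda>i. 1"] q by simp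
      finally show ?thesis .
    qed
    have "(\<integral>\<^sup>+z. ennreal (norm (T f z) powr q) \<partial>\<upsilon>)
       \<le> (\<integral>\<^sup>+z. ennreal (2 powr (q - 1)) * (ennreal (norm (T0 f z) powr q) + ennreal (norm (T1 f z) powr q)) \<partial>\<upsilon>)"
      using pw by (intro nn_integral_mono) (simp add: ennreal_leI flip: ennreal_mult ennreal_plus)
    also have "\<dots> = ennreal (2 powr (q - 1)) * ((\<integral>\<^sup>+z. ennreal (norm (T0 f z) powr q) \<partial>\<upsilon>) + (\<integral>\<^sup>+z. ennreal (norm (T1 f z) powr q) \<partial>\<upsilon>))"
      by (simp add: nn_integral_cmult nn_integral_add)
    also have "\<dots> \<le> ennreal (2 powr (q - 1)) * (ennreal (r0 powr q) + ennreal (r1 powr q))"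
      by (intro mult_left_mono add_mono I0 I1) auto
    also have "\<dots> = ennreal (2 powr (q - 1) * (r0 powr q + r1 powr q))"
      by (simp flip: ennreal_mult ennreal_plus)
    also have "\<dots> \<le> ennreal ((2 * (r0 + r1)) powr q)"
    proof (intro ennreal_leI)
      have "2 powr (q - 1) * (r0 powr q + r1 powr q) \<le> 2 powr (q - 1) * ((r0 + r1) powr q + (r0 + r1) powr q)"
        using r q by (intro mult_left_mono add_mono powr_mono2) auto
      also have "\<dots> = 2 powr (q - 1) * 2 powr 1 * (r0 + r1) powr q" by simp
      also have "\<dots> = (2 * (r0 + r1)) powr q" 
        unfolding powr_add[symmetric] using r powr_mult[of 2 "r0 + r1" q] by simp
      finally show "2 powr (q - 1) * (r0 powr q + r1 powr q) \<le> (2 * (r0 + r1)) powr q" .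
    qed
    finally show "(\<integral>\<^sup>+z. ennreal (norm (T f z) powr q) \<partial>\<upsilon>) \<le> ennreal ((2 * (r0 + r1)) powr q)" .
  qed
  also have "\<dots> = ennreal 2 * (op_norm p \<omega> q \<upsilon> T0 + op_norm p \<omega> q \<upsilon> T1)"
    using r by (subst ennreal_mult) auto
  finally show ?thesis .
qed

section \<open>The weighted area measure of a radial weight\<close>

text \<open>Measurability and sign of \<omega> are known on [0, 1] only; the cutoff in the norm
  gives a density that is measurable on the whole plane.\<close>

definition radial_measure :: "(real \<Rightarrow> real) \<Rightarrow> complex measure" where
  "radial_measure \<omega> = density lborel (\<lambda>z. indicator unit_disc z * ennreal (indicator {0..1} (norm z) * \<omega> (norm z) / pi))"

context
  fixes \<omega> :: "real \<Rightarrow> real"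
  assumes rw: "radial_weight \<omega>"
begin

lemma weight_measurable [measurable]: "(\<lambda>r. indicator {0..1} r * \<omega> r) \<in> borel_measurable borel"
  using rw borel_measurable_integrable[of lborel "\<lambda>r. indicator {0..1} r *\<^sub>R \<omega> r"]
  by (auto simp: radial_weight_def set_integrable_def)

lemma weight_nonneg: "0 \<le> indicator {0..1} r * \<omega> r"
  using rw by (auto simp: radial_weight_def indicator_def)

lemma omega_hat_nn_integral:
  assumes "0 \<le> r"
  shows "ennreal (omega_hat \<omega> r) = (\<integral>\<^sup>+t\<in>{r..1}. ennreal (indicator {0..1} t * \<omega> t) \<partial>lborel)"
proof -
  have "set_integrable lborel {r..1} \<omega>"
    using rw assms by (auto simp: radial_weight_def intro: set_integrable_subset)
  then have "(\<integral>\<^sup>+t. ennreal (indicator {r..1} t *\<^sub>R \<omega> t) \<partial>lborel) = ennreal (omega_hat \<omega> r)"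
    unfolding omega_hat_def set_lebesgue_integral_def set_integrable_def
    using rw assms by (intro nn_integral_eq_integral) (auto simp: radial_weight_def indicator_def)
  moreover have "(\<integral>\<^sup>+t. ennreal (indicator {r..1} t *\<^sub>R \<omega> t) \<partial>lborel) = (\<integral>\<^sup>+t\<in>{r..1}. ennreal (indicator {0..1} t * \<omega> t) \<partial>lborel)"
    using assms by (intro nn_integral_cong) (auto simp: indicator_def)
  ultimately show ?thesis by simp
qed

lemma omega_hat_nonneg: "0 \<le> r \<Longrightarrow> 0 \<le> omega_hat \<omega> r"
  unfolding omega_hat_def set_lebesgue_integral_def
  using rw by (intro integral_nonneg_AE) (auto simp: radial_weight_def indicator_def)

lemma omega_hat_antimono:
  assumes "0 \<le> r" "r \<le> s"
  shows "omega_hat \<omega> s \<le> omega_hat \<omega> r"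
proof -
  have "ennreal (omega_hat \<omega> s) \<le> ennreal (omega_hat \<omega> r)"
    unfolding omega_hat_nn_integral[OF assms(1)] omega_hat_nn_integral[OF order_trans[OF assms]]
    using assms by (intro nn_integral_mono) (auto simp: indicator_def)
  then show ?thesis using omega_hat_nonneg[OF assms(1)] by (simp add: ennreal_le_iff)
qed

lemma omega_hat_Icc_Ico:
  assumes "0 \<le> r" "r \<le> s" "s \<le> 1"
  shows "ennreal (omega_hat \<omega> r - omega_hat \<omega> s) \<le> (\<integral>\<^sup>+t\<in>{r..<s}. ennreal (indicator {0..1} t * \<omega> t) \<partial>lborel)"
proof -
  have "ennreal (omega_hat \<omega> r) = (\<integral>\<^sup>+t. ennreal (indicator {0..1} t * \<omega> t) * indicator {r..<s} t + ennreal (indicator {0..1} t * \<omega> t) * indicator {s..1} t \<partial>lborel)"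
    unfolding omega_hat_nn_integral[OF assms(1)] using assms by (intro nn_integral_cong) (auto simp: indicator_def)
  also have "\<dots> = (\<integral>\<^sup>+t\<in>{r..<s}. ennreal (indicator {0..1} t * \<omega> t) \<partial>lborel) + ennreal (omega_hat \<omega> s)"
    unfolding omega_hat_nn_integral[OF order_trans[OF assms(1,2)]] by (rule nn_integral_add) measurable
  finally have "ennreal (omega_hat \<omega> r) - ennreal (omega_hat \<omega> s) = (\<integral>\<^sup>+t\<in>{r..<s}. ennreal (indicator {0..1} t * \<omega> t) \<partial>lborel)"
    by simp
  then show ?thesis using assms omega_hat_nonneg[of s] by (simp add: ennreal_minus)
qed

lemma radial_density_measurable [measurable]:
  "(\<lambda>z. indicator unit_disc z * ennreal (indicator {0..1} (norm z) * \<omega> (norm z) / pi)) \<in> borel_measurable (borel :: complex measure)"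
proof -
  have [measurable]: "(indicator unit_disc :: complex \<Rightarrow> ennreal) \<in> borel_measurable borel"
    by (rule borel_measurable_indicator) simp
  have "(\<lambda>z. indicator {0..1} (norm z) * \<omega> (norm z)) \<in> borel_measurable (borel :: complex measure)"
    using measurable_compose[OF _ weight_measurable, of norm borel] by simp
  then show ?thesis by measurable
qed

lemma sets_radial_measure [simp, measurable_cong]: "sets (radial_measure \<omega>) = sets borel"
  by (simp add: radial_measure_def)

text \<open>The 2 pi r of polar coordinates meets the 1 / pi of the normalised area, leaving the
  density 2 r \<omega>(r).\<close>

lemma radial_measure_annular:
  assumes [measurable]: "S \<in> sets borel"
  shows "emeasure (radial_measure \<omega>) {z. norm z \<in> S}
     = (\<integral>\<^sup>+r. indicator {0..<1} r * (ennreal (2 * r * (indicator {0..1} r * \<omega> r)) * indicator S r) \<partial>lborel)"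
proof -
  have S: "{z. norm z \<in> S} \<in> sets (borel :: complex measure)"
    using measurable_sets[OF _ assms, of norm "borel :: complex measure"] by (simp add: vimage_def)
  define h where "h r = ennreal (indicator {0..1} r * \<omega> r / pi) * indicator S r" for r
  have [measurable]: "h \<in> borel_measurable borel" unfolding h_def by measurable
  have gm: "(\<lambda>z. indicator unit_disc z * ennreal (indicator {0..1} (norm z) * \<omega> (norm z) / pi)) \<in> borel_measurable (lborel :: complex measure)"
    by (subst measurable_cong_sets[OF sets_lborel refl]) (rule radial_density_measurable)
  have "emeasure (radial_measure \<omega>) {z. norm z \<in> S} = (\<integral>\<^sup>+z. indicator unit_disc z * h (norm z) \<partial>lborel)"
    unfolding radial_measure_def using S
    by (subst emeasure_density[OF gm]) (auto simp: h_def mult.assoc indicator_def intro!: nn_integral_cong)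
  also have "\<dots> = (\<integral>\<^sup>+r. indicator {0..<1} r * (ennreal (2 * pi * r) * h r) \<partial>lborel)"
    by (rule nn_integral_radial_unit_disc) measurable
  also have "\<dots> = (\<integral>\<^sup>+r. indicator {0..<1} r * (ennreal (2 * r * (indicator {0..1} r * \<omega> r)) * indicator S r) \<partial>lborel)"
  proof (intro nn_integral_cong)
    fix r :: real
    have "ennreal (2 * pi * r) * ennreal (indicator {0..1} r * \<omega> r / pi) = ennreal (2 * r * (indicator {0..1} r * \<omega> r))" if "0 \<le> r"
      using that weight_nonneg[of r] by (subst ennreal_mult[symmetric]) auto
    then show "indicator {0..<1} r * (ennreal (2 * pi * r) * h r) = indicator {0..<1} r * (ennreal (2 * r * (indicator {0..1} r * \<omega> r)) * indicator S r)"
      by (auto simp: h_def indicator_def mult.assoc[symmetric])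
  qed
  finally show ?thesis .
qed

lemma radial_measure_Ici_le:
  assumes "0 \<le> a" "S \<in> sets borel" "S \<subseteq> {a..}"
  shows "emeasure (radial_measure \<omega>) {z. norm z \<in> S} \<le> ennreal (2 * omega_hat \<omega> a)"
proof -
  have "emeasure (radial_measure \<omega>) {z. norm z \<in> S} \<le> (\<integral>\<^sup>+t. 2 * (ennreal (indicator {0..1} t * \<omega> t) * indicator {a..1} t) \<partial>lborel)"
    unfolding radial_measure_annular[OF assms(2)]
  proof (intro nn_integral_mono)
    fix t :: real
    have "ennreal (2 * t * (indicator {0..1} t * \<omega> t)) \<le> ennreal (2 * (indicator {0..1} t * \<omega> t))" if "t \<le> 1"
      using that weight_nonneg[of t] by (intro ennreal_leI mult_right_mono) auto
    also have "\<dots> = 2 * ennreal (indicator {0..1} t * \<omega> t)"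
      using weight_nonneg[of t] by (subst ennreal_mult) auto
    finally show "indicator {0..<1} t * (ennreal (2 * t * (indicator {0..1} t * \<omega> t)) * indicator S t)
        \<le> 2 * (ennreal (indicator {0..1} t * \<omega> t) * indicator {a..1} t)"
      using assms(3) by (auto simp: indicator_def)
  qed
  also have "\<dots> = 2 * ennreal (omega_hat \<omega> a)"
    unfolding omega_hat_nn_integral[OF assms(1)] by (rule nn_integral_cmult) measurable
  also have "\<dots> = ennreal (2 * omega_hat \<omega> a)"
    using omega_hat_nonneg[OF assms(1)] by (subst ennreal_mult) auto
  finally show ?thesis .
qed

text \<open>From radius 1/2 on, the factor 2 r is at least 1.\<close>

lemma radial_measure_Ico_ge:
  assumes "1 / 2 \<le> a" "a \<le> b" "b \<le> 1"
  shows "ennreal (omega_hat \<omega> a - omega_hat \<omega> b) \<le> emeasure (radial_measure \<omega>) {z. norm z \<in> {a..<b}}"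
proof -
  have "ennreal (omega_hat \<omega> a - omega_hat \<omega> b) \<le> (\<integral>\<^sup>+t\<in>{a..<b}. ennreal (indicator {0..1} t * \<omega> t) \<partial>lborel)"
    using assms by (intro omega_hat_Icc_Ico) auto
  also have "\<dots> \<le> emeasure (radial_measure \<omega>) {z. norm z \<in> {a..<b}}"
    unfolding radial_measure_annular[OF atLeastLessThan_borel]
  proof (intro nn_integral_mono)
    fix t :: real
    have "ennreal (1 * (indicator {0..1} t * \<omega> t)) \<le> ennreal (2 * t * (indicator {0..1} t * \<omega> t))" if "a \<le> t"
      using that assms weight_nonneg[of t] by (intro ennreal_leI mult_right_mono) auto
    then show "ennreal (indicator {0..1} t * \<omega> t) * indicator {a..<b} t
        \<le> indicator {0..<1} t * (ennreal (2 * t * (indicator {0..1} t * \<omega> t)) * indicator {a..<b} t)"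
      using assms by (auto simp: indicator_def)
  qed
  finally show ?thesis .
qed

lemma radial_measure_rotate:
  assumes "norm c = 1" and [measurable]: "f \<in> borel_measurable borel"
  shows "(\<integral>\<^sup>+z. f (c * z) \<partial>radial_measure \<omega>) = (\<integral>\<^sup>+z. f z \<partial>radial_measure \<omega>)"
proof -
  define g where "g z = (indicator unit_disc z :: ennreal) * ennreal (indicator {0..1} (norm z) * \<omega> (norm z) / pi)" for z :: complex
  have g: "g (c * z) = g z" for z using assms(1) by (simp add: g_def norm_mult indicator_def)
  have [measurable]: "g \<in> borel_measurable borel" unfolding g_def by (rule radial_density_measurable)
  have "(\<integral>\<^sup>+z. f (c * z) \<partial>radial_measure \<omega>) = (\<integral>\<^sup>+z. g (c * z) * f (c * z) \<partial>lborel)"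
    unfolding radial_measure_def g_def[symmetric] by (simp add: nn_integral_density g)
  also have "\<dots> = (\<integral>\<^sup>+z. g z * f z \<partial>lborel)"
    using nn_integral_complex_rotate[of "\<lambda>z. g z * f z" c] assms by simp
  also have "\<dots> = (\<integral>\<^sup>+z. f z \<partial>radial_measure \<omega>)"
    unfolding radial_measure_def g_def[symmetric] by (simp add: nn_integral_density)
  finally show ?thesis .
qed

text \<open>The p-th root does not move the threshold 1, so unit balls can be described by the
  integral itself.\<close>

lemma Apw_norm_le_1_iff:
  assumes p: "1 < p" and f: "f holomorphic_on unit_disc"
  shows "Apw_norm p \<omega> f \<le> 1 \<longleftrightarrow> (\<integral>\<^sup>+z\<in>unit_disc. ennreal (norm (f z) powr p) \<partial>radial_measure \<omega>) \<le> 1"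
proof -
  have fm [measurable]: "(\<lambda>w. norm (f w) * indicator unit_disc w) \<in> borel_measurable borel"
    using holomorphic_on_imp_continuous_on[OF f] by (rule borel_measurable_norm_indicator) simp
  have "(\<lambda>z. ennreal ((norm (f z) * indicator unit_disc z) powr p)) \<in> borel_measurable borel" by measurable
  moreover have "(\<lambda>z. ennreal ((norm (f z) * indicator unit_disc z) powr p)) = (\<lambda>z. ennreal (norm (f z) powr p) * indicator unit_disc z)"
    by (auto simp: indicator_def)
  ultimately have [measurable]: "(\<lambda>z. ennreal (norm (f z) powr p) * indicator unit_disc z) \<in> borel_measurable borel" by simp
  have "(\<integral>\<^sup>+z\<in>unit_disc. ennreal (norm (f z) powr p) \<partial>radial_measure \<omega>)
     = (\<integral>\<^sup>+z. indicator unit_disc z * ennreal (indicator {0..1} (norm z) * \<omega> (norm z) / pi) * (ennreal (norm (f z) powr p) * indicator unit_disc z) \<partial>lborel)"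
    unfolding radial_measure_def by (rule nn_integral_density) measurable
  also have "\<dots> = (\<integral>\<^sup>+z. indicator unit_disc z * ennreal (norm (f z) powr p * \<omega> (norm z) / pi) \<partial>lborel)"
  proof (intro nn_integral_cong)
    fix z :: complex
    show "indicator unit_disc z * ennreal (indicator {0..1} (norm z) * \<omega> (norm z) / pi) * (ennreal (norm (f z) powr p) * indicator unit_disc z)
        = indicator unit_disc z * ennreal (norm (f z) powr p * \<omega> (norm z) / pi)"
      using weight_nonneg[of "norm z"]
      by (cases "norm z < 1") (auto simp: indicator_def mult.commute simp flip: ennreal_mult)
  qed
  finally show ?thesis
    using enn_root_le_iff[of p 1] p unfolding Apw_norm_def by simp
qed

end

text \<open>B is at least K, so a step to the next level goes at least as far outwards as the lower
  condition asks and W drops by the factor 1 / C. Conversely, since B <= \<open>2 ^ B\<close>,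
  iterating the upper condition B times reaches beyond the next level, whence D =
  \<open>C0 ^ B\<close>.\<close>

lemma weights_D_radial_doubling:
  assumes \<omega>: "\<omega> \<in> weights_D"
  shows "\<exists>B W \<rho> D \<delta>. radial_doubling_measure (radial_measure \<omega>) B W \<rho> D \<delta>"
proof -
  have rw: "radial_weight \<omega>" using \<omega> by (simp add: weights_D_def weights_Dhat_def)
  obtain C0 where C0: "1 \<le> C0" "\<forall>r\<in>{0..<1}. omega_hat \<omega> r \<le> C0 * omega_hat \<omega> ((1 + r) / 2)"
    using \<omega> by (auto simp: weights_D_def weights_Dhat_def)
  obtain K C where K: "1 < K" "1 < C" "\<forall>r\<in>{0..<1}. C * omega_hat \<omega> (1 - (1 - r) / K) \<le> omega_hat \<omega> r"
    using \<omega> by (auto simp: weights_D_def)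
  define B where "B = max 2 (nat \<lceil>K\<rceil>)"
  have B: "2 \<le> B" "K \<le> real B" unfolding B_def by (simp, linarith)
  define r where "r n = 1 - 1 / real B ^ n" for n
  define W where "W n = omega_hat \<omega> (r n)" for n
  define D where "D = C0 ^ B"
  have D: "1 \<le> D" using C0 by (simp add: D_def)
  have r01: "0 \<le> r n" "r n < 1" for n using B by (auto simp: r_def)
  have rmono: "r m \<le> r n" if "m \<le> n" for m n
    unfolding r_def using that B by (intro diff_left_mono divide_left_mono power_increasing) auto
  have rSuc: "r (Suc n) = 1 - (1 - r n) / real B" for n by (simp add: r_def mult.commute)
  have Wpos: "0 < W n" for n using rw r01 by (simp add: W_def radial_weight_def)
  have WSuc: "W (Suc n) \<le> 1 / C * W n" for n
  proof -
    have "1 - (1 - r n) / K \<le> r (Suc n)"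
      unfolding rSuc using r01[of n] K B by (intro diff_left_mono divide_left_mono) auto
    moreover have "0 \<le> 1 - (1 - r n) / K" using r01[of n] K by (simp add: divide_le_eq)
    ultimately have "omega_hat \<omega> (r (Suc n)) \<le> omega_hat \<omega> (1 - (1 - r n) / K)"
      by (intro omega_hat_antimono[OF rw])
    then have "C * W (Suc n) \<le> C * omega_hat \<omega> (1 - (1 - r n) / K)" using K by (simp add: W_def)
    also have "\<dots> \<le> W n" using K r01[of n] by (simp add: W_def)
    finally show ?thesis using K by (simp add: field_simps)
  qed
  have iter: "omega_hat \<omega> x \<le> C0 ^ k * omega_hat \<omega> (1 - (1 - x) / 2 ^ k)" if "x \<in> {0..<1}" for x k
  proof (induction k)
    case (Suc k)
    let ?y = "1 - (1 - x) / 2 ^ k"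
    have y: "?y \<in> {0..<1}" using that one_le_power[of "2::real" k] by (auto simp: divide_le_eq simp del: one_le_power)
    have "(1 + ?y) / 2 = 1 - (1 - x) / 2 ^ Suc k" by (simp add: field_simps)
    then have "omega_hat \<omega> ?y \<le> C0 * omega_hat \<omega> (1 - (1 - x) / 2 ^ Suc k)" using C0(2) y by metis
    then have "C0 ^ k * omega_hat \<omega> ?y \<le> C0 ^ k * (C0 * omega_hat \<omega> (1 - (1 - x) / 2 ^ Suc k))"
      using C0 by (intro mult_left_mono) auto
    then show ?case using Suc by (simp add: mult_ac)
  qed simp
  have WD: "W n \<le> D * W (Suc n)" for n
  proof -
    have "W n \<le> D * omega_hat \<omega> (1 - (1 - r n) / 2 ^ B)" using iter[of "r n" B] r01[of n] by (simp add: W_def D_def)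
    moreover have "omega_hat \<omega> (1 - (1 - r n) / 2 ^ B) \<le> W (Suc n)"
      unfolding W_def
    proof (rule omega_hat_antimono[OF rw r01(1)])
      have "real B \<le> 2 ^ B" using less_exp[of B] by (metis less_imp_le of_nat_le_iff of_nat_numeral of_nat_power)
      then show "r (Suc n) \<le> 1 - (1 - r n) / 2 ^ B"
        unfolding rSuc using r01[of n] B by (intro diff_left_mono divide_left_mono) auto
    qed
    ultimately show ?thesis using D by (smt (verit) mult_left_mono)
  qed
  have A: "annulus B n = {z. norm z \<in> {r n..<r (Suc n)}}" for n by (auto simp: annulus_def r_def)
  \<comment> \<open>The annulus two levels out carries at least W(n + 2) - W(n + 3) >= (1 - 1/C) W(n
    + 2), and going back two levels costs D^2.\<close>
  define \<delta> where "\<delta> = (1 - 1 / C) / D\<^sup>2"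
  have "radial_doubling_measure (radial_measure \<omega>) B W (1 / C) D \<delta>"
  proof (rule radial_doubling_measure.intro)
    show "2 \<le> B" by (rule B)
    show "sets (radial_measure \<omega>) = sets borel" by (simp add: radial_measure_def)
    have "emeasure (radial_measure \<omega>) {z. norm z \<in> {0..}} \<le> ennreal (2 * omega_hat \<omega> 0)"
      by (rule radial_measure_Ici_le[OF rw]) auto
    then show "finite_measure (radial_measure \<omega>)"
      by (intro finite_measureI) (auto simp: radial_measure_def top_unique)
    show "(\<integral>\<^sup>+z. f (c * z) \<partial>radial_measure \<omega>) = (\<integral>\<^sup>+z. f z \<partial>radial_measure \<omega>)"
      if "norm c = 1" "f \<in> borel_measurable borel" for c f
      by (rule radial_measure_rotate[OF rw that])
    show "AE z in radial_measure \<omega>. norm z < 1"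
      unfolding radial_measure_def using radial_density_measurable[OF rw]
      by (subst AE_density) (auto intro!: AE_I2 simp: indicator_def)
    show "0 < W n" for n by (rule Wpos)
    show "0 < 1 / C" "1 / C < 1" using K by auto
    show "W (Suc n) \<le> 1 / C * W n" for n by (rule WSuc)
    show "0 < D" using D by simp
    show "W n \<le> D * W (Suc n)" for n by (rule WD)
    show "emeasure (radial_measure \<omega>) (annulus B n) \<le> ennreal (2 * W n)" for n
      unfolding A W_def by (rule radial_measure_Ici_le[OF rw r01(1)]) auto
    show "0 < \<delta>" using K D by (simp add: \<delta>_def)
    show "ennreal (\<delta> * W n) \<le> emeasure (radial_measure \<omega>) (annulus B (n + 2))" for n
    proof -
      \<comment> \<open>Since B is at least 2, every level from 1 on lies beyond radius 1/2, as
        \<open>radial_measure_Ico_ge\<close> requires.\<close>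
      have "1 / 2 \<le> r 1" using B by (simp add: r_def field_simps)
      then have h: "1 / 2 \<le> r (n + 2)" using rmono[of 1 "n + 2"] by simp
      have "W n \<le> D * (D * W (n + 2))"
        using order_trans[OF WD[of n] mult_left_mono[OF WD[of "Suc n"], of D]] D by simp
      then have "\<delta> * W n \<le> \<delta> * (D\<^sup>2 * W (n + 2))"
        using K D by (intro mult_left_mono) (auto simp: \<delta>_def power2_eq_square mult.assoc)
      also have "\<dots> = (1 - 1 / C) * W (n + 2)" using D by (simp add: \<delta>_def)
      also have "\<dots> \<le> W (n + 2) - W (Suc (n + 2))" using WSuc[of "n + 2"] by (simp add: algebra_simps)
      finally have "ennreal (\<delta> * W n) \<le> ennreal (W (n + 2) - W (Suc (n + 2)))" by (rule ennreal_leI)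
      also have "\<dots> \<le> emeasure (radial_measure \<omega>) (annulus B (n + 2))"
        unfolding A W_def using rmono[of "n + 2" "Suc (n + 2)"] r01[of "Suc (n + 2)"] h
        by (intro radial_measure_Ico_ge[OF rw]) auto
      finally show ?thesis .
    qed
  qed
  then show ?thesis by blast
qed

section \<open>The two-sided norm estimate\<close>

theorem theorem3p1:
  fixes p q :: real and \<omega> :: "real \<Rightarrow> real"
  assumes "1 < p" and "1 < q" and "\<omega> \<in> weights_D"
  shows "\<exists>C>0. \<forall>(\<upsilon>::complex measure) \<phi> \<psi> u0 u1.
           sets \<upsilon> = sets (restrict_space borel unit_disc) \<and>
           \<phi> \<in> self_maps \<and> \<psi> \<in> self_maps \<and>
           u0 holomorphic_on unit_disc \<and> u1 holomorphic_on unit_disc \<longrightarrow>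
           op_norm p \<omega> q \<upsilon> (\<lambda>f z. wcomp u0 \<phi> f z + wdiffcomp u1 \<psi> f z)
              \<le> ennreal C * (op_norm p \<omega> q \<upsilon> (wcomp u0 \<phi>) + op_norm p \<omega> q \<upsilon> (wdiffcomp u1 \<psi>)) \<and>
           op_norm p \<omega> q \<upsilon> (wcomp u0 \<phi>) + op_norm p \<omega> q \<upsilon> (wdiffcomp u1 \<psi>)
              \<le> ennreal C * op_norm p \<omega> q \<upsilon> (\<lambda>f z. wcomp u0 \<phi> f z + wdiffcomp u1 \<psi> f z)"
proof -
  have rw: "radial_weight \<omega>" using assms(3) by (simp add: weights_D_def weights_Dhat_def)
  have q0: "0 < q" using assms by simp
  obtain B W \<rho> D \<delta> where "radial_doubling_measure (radial_measure \<omega>) B W \<rho> D \<delta>"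
    using weights_D_radial_doubling[OF assms(3)] by blast
  then interpret radial_doubling_measure "radial_measure \<omega>" B W \<rho> D \<delta> .
  obtain C where C: "0 < C"
    and lower: "\<forall>(\<upsilon> :: complex measure) \<phi> \<psi> u0 u1 f A.
      sets \<upsilon> = sets (restrict_space borel (ball 0 1)) \<longrightarrow>
      \<phi> holomorphic_on ball 0 1 \<longrightarrow> \<phi> ` ball 0 1 \<subseteq> ball 0 1 \<longrightarrow>
      \<psi> holomorphic_on ball 0 1 \<longrightarrow> \<psi> ` ball 0 1 \<subseteq> ball 0 1 \<longrightarrow>
      u0 holomorphic_on ball 0 1 \<longrightarrow> u1 holomorphic_on ball 0 1 \<longrightarrow>
      f holomorphic_on ball 0 1 \<longrightarrow> (\<integral>\<^sup>+z\<in>ball 0 1. ennreal (norm (f z) powr p) \<partial>radial_measure \<omega>) \<le> 1 \<longrightarrow>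
      (\<forall>g. g holomorphic_on ball 0 1 \<longrightarrow> (\<integral>\<^sup>+z\<in>ball 0 1. ennreal (norm (g z) powr p) \<partial>radial_measure \<omega>) \<le> 1 \<longrightarrow>
         (\<integral>\<^sup>+z. ennreal (norm (u0 z * g (\<phi> z) + u1 z * deriv g (\<psi> z)) powr q) \<partial>\<upsilon>) \<le> A) \<longrightarrow>
      (\<integral>\<^sup>+z. ennreal (norm (u0 z * f (\<phi> z)) powr q) \<partial>\<upsilon>) \<le> ennreal C * A"
    using weighted_composition_le_sum_operator[OF assms(1,2)] by blast
  \<comment> \<open>The lower estimate compares q-th powers; c is its constant for norms.\<close>
  define c where "c = C powr (1 / q)"
  have c: "0 < c" "c powr q = C" using C q0 by (auto simp: c_def powr_powr)
  show ?thesis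
  \<comment> \<open>From R0 <= c R and R1 <= 2 (R + R0) the sum is at most (c + 2 + 2 c) R; the
    upper estimate needs only the 2.\<close>
  proof (intro exI[of _ "3 * c + 2"] conjI allI impI; (elim conjE)?)
    show "0 < 3 * c + 2" using c by simp
    fix \<upsilon> :: "complex measure" and \<phi> \<psi> u0 u1
    assume \<upsilon>: "sets \<upsilon> = sets (restrict_space borel unit_disc)"
      and "\<phi> \<in> self_maps" "\<psi> \<in> self_maps"
      and u0: "u0 holomorphic_on unit_disc" and u1: "u1 holomorphic_on unit_disc"
    then have \<phi>: "\<phi> holomorphic_on unit_disc" "\<phi> ` unit_disc \<subseteq> unit_disc"
      and \<psi>: "\<psi> holomorphic_on unit_disc" "\<psi> ` unit_disc \<subseteq> unit_disc"
      by (auto simp: self_maps_def)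
    define T where "T = (\<lambda>f z. wcomp u0 \<phi> f z + wdiffcomp u1 \<psi> f z)"
    define R R0 R1 where "R = op_norm p \<omega> q \<upsilon> T" and "R0 = op_norm p \<omega> q \<upsilon> (wcomp u0 \<phi>)"
      and "R1 = op_norm p \<omega> q \<upsilon> (wdiffcomp u1 \<psi>)"
    have m0: "wcomp u0 \<phi> f \<in> borel_measurable \<upsilon>" if "f holomorphic_on unit_disc" for f
      unfolding wcomp_def
      by (rule borel_measurable_continuous_on_disc[OF \<upsilon> continuous_on_weighted_composition[OF u0 that \<phi>]])
    have m1: "wdiffcomp u1 \<psi> f \<in> borel_measurable \<upsilon>" if "f holomorphic_on unit_disc" for f
      unfolding wdiffcomp_def
      by (rule borel_measurable_continuous_on_disc[OF \<upsilon> continuous_on_weighted_composition[OF u1 holomorphic_deriv[OF that open_ball] \<psi>]])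
    have mT: "T f \<in> borel_measurable \<upsilon>" if "f holomorphic_on unit_disc" for f
      unfolding T_def using m0[OF that] m1[OF that] by (intro borel_measurable_add) auto
    have up: "R \<le> ennreal 2 * (R0 + R1)"
      unfolding R_def R0_def R1_def
      by (rule op_norm_triangle[OF assms(2) m0 m1]) (auto simp: T_def norm_triangle_ineq)
    \<comment> \<open>The differentiation part is T minus the composition part, so bounding the
      latter by T suffices.\<close>
    have R1: "R1 \<le> ennreal 2 * (R + R0)"
      unfolding R_def R0_def R1_def
    proof (rule op_norm_triangle[OF assms(2) mT m0])
      fix f z
      show "norm (wdiffcomp u1 \<psi> f z) \<le> norm (T f z) + norm (wcomp u0 \<phi> f z)"
        using norm_triangle_ineq4[of "T f z" "wcomp u0 \<phi> f z"] by (simp add: T_def)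
    qed
    have R0: "R0 \<le> ennreal c * R"
    proof (cases R)
      case top
      then show ?thesis using c by (simp add: ennreal_mult_top)
    next
      case (real r)
      have "R0 \<le> ennreal (c * r)"
        unfolding R0_def op_norm_le_iff[OF q0 mult_nonneg_nonneg[OF less_imp_le[OF c(1)] real(1)]]
      proof (intro allI impI, elim conjE)
        fix f assume f: "f holomorphic_on unit_disc" "Apw_norm p \<omega> f \<le> 1"
        have "R \<le> ennreal r" using real by simp
        then have A: "\<forall>g. g holomorphic_on unit_disc \<longrightarrow> (\<integral>\<^sup>+z\<in>unit_disc. ennreal (norm (g z) powr p) \<partial>radial_measure \<omega>) \<le> 1 \<longrightarrow>
         (\<integral>\<^sup>+z. ennreal (norm (u0 z * g (\<phi> z) + u1 z * deriv g (\<psi> z)) powr q) \<partial>\<upsilon>) \<le> ennreal (r powr q)"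
          unfolding R_def op_norm_le_iff[OF q0 real(1)] T_def wcomp_def wdiffcomp_def
          using Apw_norm_le_1_iff[OF rw assms(1)] by blast
        have "(\<integral>\<^sup>+z. ennreal (norm (u0 z * f (\<phi> z)) powr q) \<partial>\<upsilon>) \<le> ennreal C * ennreal (r powr q)"
          using lower[rule_format, OF \<upsilon> \<phi> \<psi> u0 u1 f(1) _ A[rule_format]] f Apw_norm_le_1_iff[OF rw assms(1) f(1)] by blast
        also have "\<dots> = ennreal ((c * r) powr q)"
          using c C real(1) by (simp add: powr_mult flip: ennreal_mult)
        finally show "(\<integral>\<^sup>+z. ennreal (norm (wcomp u0 \<phi> f z) powr q) \<partial>\<upsilon>) \<le> ennreal ((c * r) powr q)"
          by (simp add: wcomp_def)
      qed
      then show ?thesis using real c by (simp add: ennreal_mult)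
    qed
    have "R \<le> ennreal (3 * c + 2) * (R0 + R1)"
      using up by (rule order_trans) (use c in \<open>auto intro!: mult_right_mono ennreal_leI simp del: ennreal_numeral\<close>)
    then show "op_norm p \<omega> q \<upsilon> (\<lambda>f z. wcomp u0 \<phi> f z + wdiffcomp u1 \<psi> f z)
              \<le> ennreal (3 * c + 2) * (op_norm p \<omega> q \<upsilon> (wcomp u0 \<phi>) + op_norm p \<omega> q \<upsilon> (wdiffcomp u1 \<psi>))"
      by (simp add: R_def R0_def R1_def T_def)
    have "R0 + R1 \<le> R0 + ennreal 2 * (R + R0)" by (intro add_left_mono R1)
    also have "\<dots> \<le> ennreal c * R + ennreal 2 * (R + ennreal c * R)"
      by (intro add_mono mult_left_mono R0 order_refl) auto
    also have "\<dots> = ennreal (3 * c + 2) * R"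
    proof -
      have "ennreal (3 * c + 2) = ennreal c + 2 * (1 + ennreal c)"
      proof -
        have "ennreal (3 * c + 2) = ennreal (c + 2 * (1 + c))" by simp
        also have "\<dots> = ennreal c + ennreal 2 * (ennreal 1 + ennreal c)"
          using c by (subst ennreal_plus, simp, simp, subst ennreal_mult, simp, simp, subst ennreal_plus) auto
        finally show ?thesis by simp
      qed
      then show ?thesis by (simp add: algebra_simps)
    qed
    finally show "op_norm p \<omega> q \<upsilon> (wcomp u0 \<phi>) + op_norm p \<omega> q \<upsilon> (wdiffcomp u1 \<psi>)
              \<le> ennreal (3 * c + 2) * op_norm p \<omega> q \<upsilon> (\<lambda>f z. wcomp u0 \<phi> f z + wdiffcomp u1 \<psi> f z)"
      by (simp add: R_def R0_def R1_def T_def)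
  qed
qed

end
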